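(* There exists a function $b:[0,T]\to\mathbb{R}$ such that $-\infty<b(t)<A$ for all $t\in[0,T)$ and $$\mathcal{D}=\{(t,x)\in[0,T)\times\mathbb{R}:x\le b(t)\}\cup\big(\{T\}\times\mathbb{R}\big).$$ Moreover, $b(t)\le\gamma(t)$ for all $t\in[0,T)$, where $$\gamma(t):=\frac{\theta(t)\alpha(t)+\lambda A}{\theta(t)+\lambda},$$ and $b(T):=\lim_{t\to T}b(t)$ exists and equals $\min\{A,\gamma(T)\}$.
   Context: Fix $T>0$, $A\in\mathbb{R}$ (strike price) and $\lambda\ge0$ (discounting rate). Let $\theta,\alpha:[0,T]\to\mathbb{R}$ be continuously differentiable with $\theta(s)>0$ for all $s\in[0,T]$. Let $X=(X_s)_{s\in[0,T]}$ be the strong solution of $$dX_s=\theta(s)(\alpha(s)-X_s)\,ds+dW_s,\quad 0\le s\le T,$$ where $W$ is a standard Brownian motion with natural filtration $(\mathcal{F}_s)_{s\in[0,T]}$. $\mathbb{P}_{t,x}$ denotes the probability measure $\mathbb{P}(\cdot\mid X_t=x)$, and $\mathbb{E}_{t,x}$ the corresponding expectation. With gain function $G(x)=(A-x)^+$, the value function is $$V(t,x)=\sup_{0\le\tau\le T-t}\mathbb{E}_{t,x}\big[e^{-\lambda\tau}G(X_{t+\tau})\big],\quad (t,x)\in[0,T]\times\mathbb{R},$$ where the supremum is over all random times $\tau\in[0,T-t]$ such that $t+\tau$ is an $(\mathcal{F}_s)$-stopping time. The stopping set is $\mathcal{D}=\{(t,x)\in[0,T]\times\mathbb{R}:V(t,x)=G(x)\}$.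 *)

theory Defs
  imports "HOL-Probability.Probability"
begin

definition continuously_differentiable_on :: "(real \<Rightarrow> real) \<Rightarrow> real set \<Rightarrow> bool" where
  "continuously_differentiable_on f S \<longleftrightarrow>
     (\<exists>f'. continuous_on S f' \<and> (\<forall>s\<in>S. (f has_real_derivative f' s) (at s within S)))"

text \<open>
  Time is represented by the type \<open>real\<close>, but a process with horizon \<open>T\<close> is only meaningful
  on \<open>{0..T}\<close>. The index is capped at \<open>T\<close>, so values of \<open>W\<close> outside \<open>{0..T}\<close> never enter.
\<close>

definition natural_filtration ::
    "'a measure \<Rightarrow> real \<Rightarrow> (real \<Rightarrow> 'a \<Rightarrow> real) \<Rightarrow> real \<Rightarrow> 'a measure" where
  "natural_filtration M T W s =
     sigma (space M) {W u -` B \<inter> space M | u B. u \<in> {0..min s T} \<and> B \<in> sets borel}"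

definition brownian_motion ::
    "'a measure \<Rightarrow> real \<Rightarrow> (real \<Rightarrow> 'a \<Rightarrow> real) \<Rightarrow> bool" where
  "brownian_motion M T W \<longleftrightarrow>
     prob_space M \<and>
     (\<forall>s\<in>{0..T}. W s \<in> borel_measurable M) \<and>
     (AE \<omega> in M. W 0 \<omega> = 0) \<and>
     (AE \<omega> in M. continuous_on {0..T} (\<lambda>s. W s \<omega>)) \<and>
     (\<forall>s u. 0 \<le> s \<and> s < u \<and> u \<le> T \<longrightarrow>
        distributed M lborel (\<lambda>\<omega>. W u \<omega> - W s \<omega>) (normal_density 0 (sqrt (u - s))) \<and>
        prob_space.indep_set M (sets (natural_filtration M T W s))
          (sets (vimage_algebra (space M) (\<lambda>\<omega>. W u \<omega> - W s \<omega>) borel)))"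

text \<open>
  \<open>Y\<close> solves \<open>dY = \<theta>(\<alpha> - Y) ds + dW\<close> on \<open>[t,T]\<close> with \<open>Y\<^sub>t = x\<close>. The diffusion coefficient
  is \<open>1\<close>, so the stochastic integral over \<open>[t,s]\<close> is the increment \<open>W\<^sub>s - W\<^sub>t\<close>. The solution is
  strong: it lives on the given space, is driven by the given \<open>W\<close>, and is adapted to the
  filtration of \<open>W\<close>.
\<close>

definition ou_strong_solution ::
    "'a measure \<Rightarrow> real \<Rightarrow> (real \<Rightarrow> 'a \<Rightarrow> real) \<Rightarrow> (real \<Rightarrow> real) \<Rightarrow> (real \<Rightarrow> real) \<Rightarrow>
     real \<Rightarrow> real \<Rightarrow> (real \<Rightarrow> 'a \<Rightarrow> real) \<Rightarrow> bool" where
  "ou_strong_solution M T W \<theta> \<alpha> t x Y \<longleftrightarrow>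
     (\<forall>s\<in>{t..T}. Y s \<in> borel_measurable (natural_filtration M T W s)) \<and>
     (AE \<omega> in M. continuous_on {t..T} (\<lambda>s. Y s \<omega>)) \<and>
     (AE \<omega> in M. \<forall>s\<in>{t..T}.
        Y s \<omega> = x + integral {t..s} (\<lambda>u. \<theta> u * (\<alpha> u - Y u \<omega>)) + (W s \<omega> - W t \<omega>))"

definition gain :: "real \<Rightarrow> real \<Rightarrow> real" where
  "gain A x = max (A - x) 0"

definition admissible_times ::
    "'a measure \<Rightarrow> real \<Rightarrow> (real \<Rightarrow> 'a \<Rightarrow> real) \<Rightarrow> real \<Rightarrow> ('a \<Rightarrow> real) set" where
  "admissible_times M T W t =
     {\<tau>. (\<forall>\<omega>\<in>space M. 0 \<le> \<tau> \<omega> \<and> \<tau> \<omega> \<le> T - t) \<and>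
         stopping_time (natural_filtration M T W) (\<lambda>\<omega>. t + \<tau> \<omega>)}"

text \<open>
  The event \<open>X\<^sub>t = x\<close> is in general a null set, so conditioning on it for every \<open>(t,x)\<close> is
  understood, as usual for diffusions, through the solution started from \<open>x\<close> at time \<open>t\<close>:
  \<open>X t x s\<close> is the state at time \<open>s\<close> of that solution, and the expectation under \<open>P\<^sub>t\<^sub>,\<^sub>x\<close> of a
  functional of \<open>(X\<^sub>s)\<close>, \<open>s \<ge> t\<close>, is the expectation under \<open>M\<close> of the same functional of
  \<open>X t x\<close>. The payoff is nonnegative, so the expectation and the supremum are taken in
  \<open>ennreal\<close>, where neither integrability nor boundedness has to be presupposed.
  The discount rate is written \<open>\<rho>\<close>.
\<close>

definition value_function ::
    "'a measure \<Rightarrow> real \<Rightarrow> (real \<Rightarrow> 'a \<Rightarrow> real) \<Rightarrow> (real \<Rightarrow> real \<Rightarrow> real \<Rightarrow> 'a \<Rightarrow> real) \<Rightarrow>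
     real \<Rightarrow> real \<Rightarrow> real \<Rightarrow> real \<Rightarrow> ennreal" where
  "value_function M T W X \<rho> A t x =
     (SUP \<tau>\<in>admissible_times M T W t.
        \<integral>\<^sup>+\<omega>. ennreal (exp (- \<rho> * \<tau> \<omega>) * gain A (X t x (t + \<tau> \<omega>) \<omega>)) \<partial>M)"

definition stopping_set ::
    "'a measure \<Rightarrow> real \<Rightarrow> (real \<Rightarrow> 'a \<Rightarrow> real) \<Rightarrow> (real \<Rightarrow> real \<Rightarrow> real \<Rightarrow> 'a \<Rightarrow> real) \<Rightarrow>
     real \<Rightarrow> real \<Rightarrow> (real \<times> real) set" where
  "stopping_set M T W X \<rho> A =
     {(t, x). t \<in> {0..T} \<and> value_function M T W X \<rho> A t x = ennreal (gain A x)}"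

end

theory Submission
  imports Defs
begin

text \<open>
  Write \<open>X = \<mu> + Z\<close> with \<open>\<mu>\<close> the solution of the noiseless equation; \<open>Z\<close> does not depend on the
  starting point, so \<open>V\<close> is nonincreasing and 1-Lipschitz in \<open>x\<close>, and each time section of the
  stopping set is a closed half-line below \<open>A\<close> once it is nonempty. For \<open>x > \<gamma>(t)\<close> a short
  deterministic waiting time beats stopping at once.

  For the converse, with \<open>h\<close> the remaining time, the function
  \<open>U(s,z) = e\<^bsup>-\<rho>(s-t)\<^esup> (A - \<mu>(s) - z) + K (T - s) z\<^sup>2 + \<kappa> z\<^sup>4\<close>
  dominates the discounted gain when \<open>A - \<mu>\<close> is bounded below by a positive constant: the quartic
  pays for the kink of the gain, and the decay in time of the quadratic pays for the Ito
  correction of the quartic. If the drift of the discounted gain is at most \<open>-\<delta>\<close> along \<open>\<mu>\<close> and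
  \<open>h\<close> is small relative to \<open>\<delta>\<close>, then \<open>U\<close> is a supersolution with \<open>U(t,0) = A - x\<close>, so stopping at
  once is optimal. This applies when \<open>x\<close> is very negative (\<open>\<delta>\<close> is large) and when
  \<open>x < min A (\<gamma>(T))\<close> and \<open>t\<close> is close to \<open>T\<close> (\<open>h\<close> is small).

  Stochastic calculus is avoided: \<open>Z\<close> is the pathwise limit of an Euler scheme driven by the
  independent increments of \<open>W\<close>, the supermartingale inequality for \<open>U\<close> is an elementary moment
  computation along the scheme, and Fatou's lemma passes to the limit.
\<close>

subsection \<open>A pathwise Euler scheme\<close>

text \<open>The linear drift is frozen at the left end of each step, but \<open>\<theta>\<close>
  enters through its exact integral over the step. The oscillation of the solution is then the only
  source of error; that of \<open>\<theta>\<close> does not contribute.\<close>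

fun euler :: "(real \<Rightarrow> real) \<Rightarrow> real \<Rightarrow> real \<Rightarrow> (real \<Rightarrow> real) \<Rightarrow> nat \<Rightarrow> real" where
  "euler \<theta> t \<eta> w 0 = 0"
| "euler \<theta> t \<eta> w (Suc i) =
     (1 - integral {t + real i * \<eta>..t + real (Suc i) * \<eta>} \<theta>) * euler \<theta> t \<eta> w i
     + (w (t + real (Suc i) * \<eta>) - w (t + real i * \<eta>))"

lemma euler_error:
  fixes Z w \<theta> :: "real \<Rightarrow> real"
  assumes Z: "continuous_on {t..T} Z"
    and sol: "\<And>s. s \<in> {t..T} \<Longrightarrow> Z s = w s - w t - integral {t..s} (\<lambda>u. \<theta> u * Z u)"
    and \<theta>: "continuous_on {t..T} \<theta>" "\<And>s. s \<in> {t..T} \<Longrightarrow> 0 \<le> \<theta> s \<and> \<theta> s \<le> C"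
    and \<eta>: "0 < \<eta>" "C * \<eta> \<le> 1"
    and osc: "\<And>u v. u \<in> {t..T} \<Longrightarrow> v \<in> {t..T} \<Longrightarrow> \<bar>u - v\<bar> \<le> \<eta> \<Longrightarrow> \<bar>Z u - Z v\<bar> \<le> \<epsilon>"
  shows "t + real i * \<eta> \<le> T \<Longrightarrow> \<bar>Z (t + real i * \<eta>) - euler \<theta> t \<eta> w i\<bar> \<le> real i * (C * \<eta> * \<epsilon>)"
proof (induction i)
  case 0
  then show ?case using sol[of t] by simp
next
  case (Suc i)
  define p q where "p = t + real i * \<eta>" and "q = t + real (Suc i) * \<eta>"
  have pq: "t \<le> p" "p \<le> q" "q \<le> T" "q - p = \<eta>"
    using Suc.prems \<eta>(1) by (auto simp: p_def q_def algebra_simps)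
  have sub: "{p..q} \<subseteq> {t..T}" using pq by auto
  have i\<theta>: "\<theta> integrable_on {p..q}"
    using continuous_on_subset[OF \<theta>(1) sub] by (rule integrable_continuous_real)
  have i\<theta>Z: "(\<lambda>u. \<theta> u * Z u) integrable_on {p..q}"
    by (intro integrable_continuous_real continuous_intros continuous_on_subset[OF \<theta>(1) sub]
        continuous_on_subset[OF Z sub])
  have i\<theta>Z': "(\<lambda>u. \<theta> u * Z u) integrable_on {t..q}"
    by (intro integrable_continuous_real continuous_intros continuous_on_subset[OF \<theta>(1)]
        continuous_on_subset[OF Z]) (use pq in auto)
  have "integral {t..p} (\<lambda>u. \<theta> u * Z u) + integral {p..q} (\<lambda>u. \<theta> u * Z u) = integral {t..q} (\<lambda>u. \<theta> u * Z u)"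
    using pq i\<theta>Z' by (intro Henstock_Kurzweil_Integration.integral_combine) auto
  then have Zq: "Z q = Z p - integral {p..q} (\<lambda>u. \<theta> u * Z u) + (w q - w p)"
    using sol[of q] sol[of p] pq by auto
  \<comment> \<open>The first summand is the drift used by the scheme, the second is the local
    error.\<close>
  have split: "integral {p..q} (\<lambda>u. \<theta> u * Z u) = integral {p..q} \<theta> * Z p + integral {p..q} (\<lambda>u. \<theta> u * (Z u - Z p))"
  proof -
    have "integral {p..q} (\<lambda>u. \<theta> u * (Z u - Z p)) = integral {p..q} (\<lambda>u. \<theta> u * Z u - \<theta> u * Z p)"
      by (simp add: algebra_simps)
    also have "\<dots> = integral {p..q} (\<lambda>u. \<theta> u * Z u) - integral {p..q} (\<lambda>u. \<theta> u * Z p)"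
      by (rule Henstock_Kurzweil_Integration.integral_diff[OF i\<theta>Z]) (intro integrable_on_mult_left i\<theta>)
    also have "integral {p..q} (\<lambda>u. \<theta> u * Z p) = integral {p..q} \<theta> * Z p"
      by simp
    finally show ?thesis by simp
  qed
  have \<epsilon>: "0 \<le> \<epsilon>" using osc[of p p] pq \<eta> by auto
  have a: "0 \<le> integral {p..q} \<theta>" "integral {p..q} \<theta> \<le> 1"
  proof -
    show "0 \<le> integral {p..q} \<theta>"
      using \<theta>(2) sub by (intro Henstock_Kurzweil_Integration.integral_nonneg i\<theta>) auto
    have "norm (integral {p..q} \<theta>) \<le> C * (q - p)"
      using \<theta>(2) sub pq by (intro integral_bound continuous_on_subset[OF \<theta>(1) sub]) (auto)
    then show "integral {p..q} \<theta> \<le> 1" using pq \<eta> by simp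
  qed
  have r: "\<bar>integral {p..q} (\<lambda>u. \<theta> u * (Z u - Z p))\<bar> \<le> C * \<eta> * \<epsilon>"
  proof -
    have "norm (integral {p..q} (\<lambda>u. \<theta> u * (Z u - Z p))) \<le> (C * \<epsilon>) * (q - p)"
    proof (rule integral_bound)
      show "continuous_on {p..q} (\<lambda>u. \<theta> u * (Z u - Z p))"
        by (intro continuous_intros continuous_on_subset[OF \<theta>(1) sub] continuous_on_subset[OF Z sub])
      fix u assume u: "u \<in> {p..q}"
      have "\<bar>Z u - Z p\<bar> \<le> \<epsilon>" using u pq by (intro osc) auto
      moreover have "0 \<le> \<theta> u" "\<theta> u \<le> C" using \<theta>(2)[of u] u sub by auto
      ultimately show "norm (\<theta> u * (Z u - Z p)) \<le> C * \<epsilon>"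
        by (auto simp: abs_mult intro!: mult_mono)
    qed (use pq in auto)
    then show ?thesis using pq by (simp add: mult_ac)
  qed
  have E: "euler \<theta> t \<eta> w (Suc i) = (1 - integral {p..q} \<theta>) * euler \<theta> t \<eta> w i + (w q - w p)"
    by (simp add: p_def q_def)
  have "Z q - euler \<theta> t \<eta> w (Suc i) = (1 - integral {p..q} \<theta>) * (Z p - euler \<theta> t \<eta> w i)
      - integral {p..q} (\<lambda>u. \<theta> u * (Z u - Z p))"
    unfolding E Zq split by (simp add: algebra_simps)
  also have "\<bar>\<dots>\<bar> \<le> \<bar>(1 - integral {p..q} \<theta>) * (Z p - euler \<theta> t \<eta> w i)\<bar> + C * \<eta> * \<epsilon>"
    using r by linarith
  also have "\<bar>(1 - integral {p..q} \<theta>) * (Z p - euler \<theta> t \<eta> w i)\<bar> \<le> \<bar>Z p - euler \<theta> t \<eta> w i\<bar>"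
    using a by (auto simp: abs_mult intro!: mult_left_le_one_le)
  also have "\<dots> \<le> real i * (C * \<eta> * \<epsilon>)"
    using Suc.IH pq unfolding p_def by simp
  finally show ?case unfolding q_def[symmetric] by (simp add: algebra_simps)
qed

text \<open>At most \<open>n\<close> steps of length \<open>h / n\<close> give a total error of at
  most \<open>C * h * \<epsilon>\<close>, and uniform continuity makes \<open>\<epsilon>\<close>
  arbitrarily small. The index \<open>k n\<close> may vary with \<open>n\<close> because the scheme
  is later read off at a discretised stopping time.\<close>

lemma euler_tendsto:
  fixes Z w \<theta> :: "real \<Rightarrow> real"
  assumes h: "0 < h"
    and Z: "continuous_on {t..t + h} Z"
    and sol: "\<And>s. s \<in> {t..t + h} \<Longrightarrow> Z s = w s - w t - integral {t..s} (\<lambda>u. \<theta> u * Z u)"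
    and \<theta>: "continuous_on {t..t + h} \<theta>" "\<And>s. s \<in> {t..t + h} \<Longrightarrow> 0 \<le> \<theta> s \<and> \<theta> s \<le> C"
    and k: "\<And>n. k n \<le> n" "(\<lambda>n. t + real (k n) * (h / real n)) \<longlonglongrightarrow> s"
  shows "(\<lambda>n. euler \<theta> t (h / real n) w (k n)) \<longlonglongrightarrow> Z s"
proof -
  have C: "0 \<le> C" using \<theta>(2)[of t] h by auto
  have grid: "t + real (k n) * (h / real n) \<in> {t..t + h}" for n
  \<comment> \<open>For \<open>n = 0\<close> the step \<open>h / real n\<close> is 0 by convention,
    and the grid point is \<open>t\<close>.\<close>
  proof (cases "n = 0")
    case True then show ?thesis using h by simp
  next
    case False
    have "real (k n) * (h / real n) \<le> real n * (h / real n)"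
      using k(1) h by (intro mult_right_mono) auto
    then show ?thesis using h False by auto
  qed
  have s: "s \<in> {t..t + h}"
    by (rule closed_sequentially[OF _ grid k(2)]) simp
  have "(\<lambda>n. Z (t + real (k n) * (h / real n))) \<longlonglongrightarrow> Z s"
    using grid by (intro continuous_on_tendsto_compose[OF Z k(2) s] always_eventually) auto
  moreover have "(\<lambda>n. Z (t + real (k n) * (h / real n)) - euler \<theta> t (h / real n) w (k n)) \<longlonglongrightarrow> 0"
  proof (rule LIMSEQ_I)
    fix r :: real assume r: "0 < r"
    \<comment> \<open>The summand 1 keeps \<open>K\<close> positive when \<open>C = 0\<close>, so
      that division by \<open>K\<close> is safe.\<close>
    define K where "K = C * h + 1"
    define \<epsilon> where "\<epsilon> = r / 2 / K"
    have Ch: "0 < K" using C h by (simp add: K_def add_nonneg_pos)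
    have \<epsilon>: "0 < \<epsilon>" using r Ch by (simp add: \<epsilon>_def)
    have "uniformly_continuous_on {t..t + h} Z" by (rule compact_uniformly_continuous[OF Z]) simp
    then obtain d where d: "0 < d" "\<And>u v. u \<in> {t..t + h} \<Longrightarrow> v \<in> {t..t + h} \<Longrightarrow> dist v u < d \<Longrightarrow> dist (Z v) (Z u) < \<epsilon>"
      using \<epsilon> unfolding uniformly_continuous_on_def by metis
    have lim: "(\<lambda>n. h / real n) \<longlonglongrightarrow> 0" by (rule lim_const_over_n)
    have lim': "(\<lambda>n. C * (h / real n)) \<longlonglongrightarrow> 0" using tendsto_mult_left[OF lim, of C] by simp
    have "eventually (\<lambda>n. h / real n < d \<and> C * (h / real n) < 1 \<and> 0 < n) sequentially"
      using order_tendstoD(2)[OF lim d(1)] order_tendstoD(2)[OF lim', of 1] eventually_gt_at_top[of 0]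
      by (auto simp: eventually_conj_iff)
    then obtain n0 where n0: "\<And>n. n \<ge> n0 \<Longrightarrow> h / real n < d \<and> C * (h / real n) < 1 \<and> 0 < n"
      by (auto simp: eventually_sequentially)
    have "norm (Z (t + real (k n) * (h / real n)) - euler \<theta> t (h / real n) w (k n) - 0) < r" if n: "n \<ge> n0" for n
    proof -
      define \<eta> where "\<eta> = h / real n"
      have n': "\<eta> < d" "C * \<eta> \<le> 1" "0 < \<eta>" "0 < n" using n0[OF n] h by (auto simp: \<eta>_def)
      have "\<bar>Z (t + real (k n) * \<eta>) - euler \<theta> t \<eta> w (k n)\<bar> \<le> real (k n) * (C * \<eta> * \<epsilon>)"
      proof (rule euler_error[OF Z sol \<theta>])
        show "\<bar>Z u - Z v\<bar> \<le> \<epsilon>" if "u \<in> {t..t + h}" "v \<in> {t..t + h}" "\<bar>u - v\<bar> \<le> \<eta>" for u v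
          using d(2)[of v u] that n' by (simp add: dist_real_def)
        show "t + real (k n) * \<eta> \<le> t + h" using grid[of n] by (simp add: \<eta>_def)
      qed (use n' in auto)
      also have "real (k n) * (C * \<eta> * \<epsilon>) \<le> real n * (C * \<eta> * \<epsilon>)"
        using k(1) C n' \<epsilon> by (intro mult_right_mono mult_nonneg_nonneg) auto
      also have "\<dots> = (C * h) * \<epsilon>" using n' by (simp add: \<eta>_def)
      also have "\<dots> \<le> K * \<epsilon>" using \<epsilon> by (simp add: K_def algebra_simps)
      also have "\<dots> = r / 2" using Ch by (simp add: \<epsilon>_def)
      also have "\<dots> < r" using r by simp
      finally show ?thesis by (simp add: \<eta>_def)
    qed
    then show "\<exists>no. \<forall>n\<ge>no. norm (Z (t + real (k n) * (h / real n)) - euler \<theta> t (h / real n) w (k n) - 0) < r"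
      by blast
  qed
  ultimately show ?thesis
    using tendsto_diff[of "\<lambda>n. Z (t + real (k n) * (h / real n))" "Z s" sequentially
        "\<lambda>n. Z (t + real (k n) * (h / real n)) - euler \<theta> t (h / real n) w (k n)" 0] by simp
qed

subsection \<open>The noise filtration\<close>

lemma (in prob_space) centered_normal_integrable_power:
  assumes "0 < \<sigma>" and D: "distributed M lborel Y (normal_density 0 \<sigma>)"
  shows "integrable M (\<lambda>\<omega>. Y \<omega> ^ k)"
  using distributed_integrable[OF D, of "\<lambda>x. x ^ k"] integrable_normal_moment[OF assms(1), of 0 k]
  by simp

text \<open>Four moments suffice, since the supersolution is a polynomial of degree four in the
  noise.\<close>

lemma (in prob_space) centered_normal_moments:
  assumes \<sigma>: "0 < \<sigma>" and D: "distributed M lborel Y (normal_density 0 \<sigma>)"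
  shows "expectation Y = 0"
    and "expectation (\<lambda>\<omega>. Y \<omega> ^ 2) = \<sigma>\<^sup>2"
    and "expectation (\<lambda>\<omega>. Y \<omega> ^ 3) = 0"
    and "expectation (\<lambda>\<omega>. Y \<omega> ^ 4) = 3 * \<sigma> ^ 4"
proof -
  have E: "expectation (\<lambda>\<omega>. Y \<omega> ^ k) = (\<integral>x. normal_density 0 \<sigma> x * (x - 0) ^ k \<partial>lborel)" for k
    using distributed_integral[OF D, of "\<lambda>x. x ^ k"] by simp
  show "expectation Y = 0" using normal_distributed_expectation[OF \<sigma> D] .
  show "expectation (\<lambda>\<omega>. Y \<omega> ^ 2) = \<sigma>\<^sup>2"
    unfolding E using integral_normal_moment_even[OF \<sigma>, of 0 1] by simp
  show "expectation (\<lambda>\<omega>. Y \<omega> ^ 3) = 0"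
    unfolding E using integral_normal_moment_odd[OF \<sigma>, of 0 1] by (simp add: numeral_3_eq_3)
  show "expectation (\<lambda>\<omega>. Y \<omega> ^ 4) = 3 * \<sigma> ^ 4"
    unfolding E using integral_normal_moment_even[OF \<sigma>, of 0 2] \<sigma>
    by (simp add: fact_numeral field_simps power2_eq_square eval_nat_numeral)
qed

locale ou_stopping =
  fixes M :: "'a measure" and W :: "real \<Rightarrow> 'a \<Rightarrow> real"
    and X :: "real \<Rightarrow> real \<Rightarrow> real \<Rightarrow> 'a \<Rightarrow> real"
    and \<theta> \<alpha> :: "real \<Rightarrow> real" and T A \<rho> :: real
  assumes T_pos: "T > 0" and \<rho>_nonneg: "\<rho> \<ge> 0"
    and \<theta>_cont: "continuous_on {0..T} \<theta>" and \<alpha>_cont: "continuous_on {0..T} \<alpha>"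
    and \<theta>_pos: "\<And>s. s \<in> {0..T} \<Longrightarrow> \<theta> s > 0"
    and brownian: "brownian_motion M T W"
    and solution: "\<And>t x. t \<in> {0..T} \<Longrightarrow> ou_strong_solution M T W \<theta> \<alpha> t x (X t x)"
begin

sublocale prob_space M
  using brownian by (simp add: brownian_motion_def)

abbreviation "F \<equiv> natural_filtration M T W"
abbreviation "V \<equiv> value_function M T W X \<rho> A"

lemma W_measurable: "s \<in> {0..T} \<Longrightarrow> W s \<in> borel_measurable M"
  using brownian by (simp add: brownian_motion_def)

lemma space_F [simp]: "space (F s) = space M"
  unfolding natural_filtration_def by (rule space_measure_of) auto

lemma sets_F: "sets (F s) = sigma_sets (space M) {W u -` B \<inter> space M | u B. u \<in> {0..min s T} \<and> B \<in> sets borel}"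
  unfolding natural_filtration_def by (rule sets_measure_of) auto

lemma sets_F_subset: "sets (F s) \<subseteq> sets M"
  unfolding sets_F by (rule sets.sigma_sets_subset) (auto intro!: measurable_sets[OF W_measurable])

lemma sets_F_mono: "s \<le> u \<Longrightarrow> sets (F s) \<subseteq> sets (F u)"
  unfolding sets_F by (rule sigma_sets_mono') (force simp: min_def split: if_splits)

lemma measurable_F_mono:
  assumes "s \<le> u" "f \<in> borel_measurable (F s)"
  shows "f \<in> borel_measurable (F u)"
  using assms sets_F_mono[of s u] by (auto simp: measurable_def)

lemma measurable_F_M: "f \<in> borel_measurable (F s) \<Longrightarrow> f \<in> borel_measurable M"
  using sets_F_subset[of s] by (auto simp: measurable_def)

lemma W_measurable_F: "0 \<le> u \<Longrightarrow> u \<le> s \<Longrightarrow> u \<le> T \<Longrightarrow> W u \<in> borel_measurable (F s)"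
  by (rule measurableI) (auto simp: sets_F intro!: sigma_sets.Basic)

lemma increment_normal:
  "0 \<le> s \<Longrightarrow> s < u \<Longrightarrow> u \<le> T \<Longrightarrow>
    distributed M lborel (\<lambda>\<omega>. W u \<omega> - W s \<omega>) (normal_density 0 (sqrt (u - s)))"
  using brownian by (simp add: brownian_motion_def)

text \<open>The \<sigma>-algebra generated by \<open>f\<close> is contained in \<open>F s\<close>,
  and independence passes to smaller families of sets.\<close>

lemma increment_indep:
  assumes s: "0 \<le> s" "s < u" "u \<le> T" and f: "f \<in> borel_measurable (F s)"
  shows "indep_var borel f borel (\<lambda>\<omega>. W u \<omega> - W s \<omega>)"
proof -
  have "indep_set (sets (F s)) (sets (vimage_algebra (space M) (\<lambda>\<omega>. W u \<omega> - W s \<omega>) borel))"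
    using brownian s by (simp add: brownian_motion_def)
  moreover have "sigma_sets (space M) {f -` A \<inter> space M | A. A \<in> sets borel} \<subseteq> sets (F s)"
    using sets.sigma_sets_subset[of "{f -` A \<inter> space M | A. A \<in> sets borel}" "F s"] measurable_sets[OF f]
    by auto
  ultimately have "indep_set (sigma_sets (space M) {f -` A \<inter> space M | A. A \<in> sets borel})
      (sets (vimage_algebra (space M) (\<lambda>\<omega>. W u \<omega> - W s \<omega>) borel))"
    unfolding indep_set_def by (elim indep_sets_mono_sets) (auto split: bool.split)
  then show ?thesis
    unfolding indep_var_eq sets_vimage_algebra
    using measurable_F_M[OF f] W_measurable[of s] W_measurable[of u] s by auto
qed

lemma increment_product:
  assumes s: "0 \<le> s" "s < u" "u \<le> T" and f: "f \<in> borel_measurable (F s)" "integrable M f"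
  shows "integrable M (\<lambda>\<omega>. f \<omega> * (W u \<omega> - W s \<omega>) ^ k)"
    and "expectation (\<lambda>\<omega>. f \<omega> * (W u \<omega> - W s \<omega>) ^ k) = expectation f * expectation (\<lambda>\<omega>. (W u \<omega> - W s \<omega>) ^ k)"
proof -
  have "indep_var borel (id \<circ> f) borel ((\<lambda>y. y ^ k) \<circ> (\<lambda>\<omega>. W u \<omega> - W s \<omega>))"
    by (rule indep_var_compose[OF increment_indep[OF s f(1)]]) auto
  then have ind: "indep_var borel f borel (\<lambda>\<omega>. (W u \<omega> - W s \<omega>) ^ k)"
    by (simp add: comp_def)
  have i: "integrable M (\<lambda>\<omega>. (W u \<omega> - W s \<omega>) ^ k)"
    by (rule centered_normal_integrable_power[OF _ increment_normal[OF s]]) (use s in simp)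
  show "integrable M (\<lambda>\<omega>. f \<omega> * (W u \<omega> - W s \<omega>) ^ k)"
    using indep_var_integrable[OF ind f(2) i] .
  show "expectation (\<lambda>\<omega>. f \<omega> * (W u \<omega> - W s \<omega>) ^ k) = expectation f * expectation (\<lambda>\<omega>. (W u \<omega> - W s \<omega>) ^ k)"
    using indep_var_lebesgue_integral[OF ind f(2) i] .
qed

lemma increment_moments:
  assumes s: "0 \<le> s" "s < u" "u \<le> T"
  shows "expectation (\<lambda>\<omega>. W u \<omega> - W s \<omega>) = 0"
    and "expectation (\<lambda>\<omega>. (W u \<omega> - W s \<omega>) ^ 2) = u - s"
    and "expectation (\<lambda>\<omega>. (W u \<omega> - W s \<omega>) ^ 3) = 0"
    and "expectation (\<lambda>\<omega>. (W u \<omega> - W s \<omega>) ^ 4) = 3 * (u - s)\<^sup>2"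
proof -
  have p: "0 < sqrt (u - s)" using s by simp
  have "sqrt (u - s) ^ 4 = ((sqrt (u - s))\<^sup>2)\<^sup>2" by (simp add: power_mult[symmetric])
  then have q: "sqrt (u - s) ^ 4 = (u - s)\<^sup>2" using s by simp
  note m = centered_normal_moments[OF p increment_normal[OF s]]
  show "expectation (\<lambda>\<omega>. W u \<omega> - W s \<omega>) = 0" by (rule m(1))
  show "expectation (\<lambda>\<omega>. (W u \<omega> - W s \<omega>) ^ 2) = u - s" using m(2) s by simp
  show "expectation (\<lambda>\<omega>. (W u \<omega> - W s \<omega>) ^ 3) = 0" by (rule m(3))
  show "expectation (\<lambda>\<omega>. (W u \<omega> - W s \<omega>) ^ 4) = 3 * (u - s)\<^sup>2" using m(4) q by simp
qed

text \<open>Testing against the indicator of an arbitrary \<open>G\<close> in \<open>F s\<close>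
  takes the place of conditioning on \<open>F s\<close>. After expansion in powers of the increment,
  the odd moments vanish and the second and fourth are \<open>\<eta>\<close> and
  \<open>3 * \<eta>\<^sup>2\<close>.\<close>

lemma quartic_increment_expectation:
  fixes a c e q \<kappa> s u :: real
  assumes s: "0 \<le> s" "s < u" "u \<le> T" and G: "G \<in> sets (F s)"
    and Z: "Z \<in> borel_measurable (F s)" "\<And>k. integrable M (\<lambda>\<omega>. Z \<omega> ^ k)"
  defines "Z' \<equiv> \<lambda>\<omega>. a * Z \<omega> + (W u \<omega> - W s \<omega>)" and "\<eta> \<equiv> u - s"
  shows "expectation (\<lambda>\<omega>. indicator G \<omega> * (c - e * Z' \<omega> + q * Z' \<omega> ^ 2 + \<kappa> * Z' \<omega> ^ 4)) =
    expectation (\<lambda>\<omega>. indicator G \<omega> * (c - e * (a * Z \<omega>) + q * (a\<^sup>2 * Z \<omega> ^ 2 + \<eta>)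
      + \<kappa> * (a ^ 4 * Z \<omega> ^ 4 + 6 * a\<^sup>2 * \<eta> * Z \<omega> ^ 2 + 3 * \<eta>\<^sup>2)))" (is "?L = ?R")
proof -
  let ?\<xi> = "\<lambda>\<omega>. W u \<omega> - W s \<omega>"
  \<comment> \<open>\<open>P k (Z \<omega>)\<close> is the coefficient of the \<open>k\<close>-th
    power of the increment when the quartic is expanded at \<open>a * Z \<omega>\<close>.\<close>
  define P where "P k z = (if k = 0 then c - e * a * z + q * a\<^sup>2 * z ^ 2 + \<kappa> * a ^ 4 * z ^ 4
     else if k = 1 then - e + 2 * q * a * z + 4 * \<kappa> * a ^ 3 * z ^ 3
     else if k = 2 then q + 6 * \<kappa> * a\<^sup>2 * z ^ 2
     else if k = 3 then 4 * \<kappa> * a * z else \<kappa>)" for k :: nat and z :: real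
  have Zi: "integrable M Z" using Z(2)[of 1] by simp
  have GM: "G \<in> sets M" using G sets_F_subset by blast
  have iG: "integrable M (\<lambda>\<omega>. indicator G \<omega> * f \<omega>)" if "integrable M f" for f :: "'a \<Rightarrow> real"
    using integrable_mult_indicator[OF GM that] by simp
  have iP: "integrable M (\<lambda>\<omega>. indicator G \<omega> * P k (Z \<omega>))" for k
  proof (rule iG)
    consider "k = 0" | "k = 1" | "k = 2" | "k = 3" | "k \<noteq> 0" "k \<noteq> 1" "k \<noteq> 2" "k \<noteq> 3" by blast
    then show "integrable M (\<lambda>\<omega>. P k (Z \<omega>))"
      by cases (simp_all add: P_def Zi Z(2))
  qed
  have mP: "(\<lambda>\<omega>. indicator G \<omega> * P k (Z \<omega>)) \<in> borel_measurable (F s)" for k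
    using Z(1) G unfolding P_def by measurable
  note ip = increment_product[OF s mP iP]
  have sum: "indicator G \<omega> * (c - e * Z' \<omega> + q * Z' \<omega> ^ 2 + \<kappa> * Z' \<omega> ^ 4) =
      (\<Sum>k<5. indicator G \<omega> * P k (Z \<omega>) * ?\<xi> \<omega> ^ k)" for \<omega>
    unfolding Z'_def
    by (simp add: P_def numeral_eq_Suc algebra_simps)
  have "?L = (\<Sum>k<5. expectation (\<lambda>\<omega>. indicator G \<omega> * P k (Z \<omega>) * ?\<xi> \<omega> ^ k))"
    unfolding sum by (rule Bochner_Integration.integral_sum) (rule ip)
  also have "\<dots> = (\<Sum>k<5. expectation (\<lambda>\<omega>. indicator G \<omega> * P k (Z \<omega>)) * expectation (\<lambda>\<omega>. ?\<xi> \<omega> ^ k))"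
    unfolding ip(2) ..
  also have "\<dots> = (\<Sum>k<5. expectation (\<lambda>\<omega>. indicator G \<omega> * P k (Z \<omega>) * expectation (\<lambda>\<omega>. ?\<xi> \<omega> ^ k)))"
    by simp
  also have "\<dots> = expectation (\<lambda>\<omega>. \<Sum>k<5. indicator G \<omega> * P k (Z \<omega>) * expectation (\<lambda>\<omega>. ?\<xi> \<omega> ^ k))"
    by (rule Bochner_Integration.integral_sum[symmetric]) (intro integrable_mult_left iP)
  also have "\<dots> = ?R"
  proof (rule Bochner_Integration.integral_cong[OF refl])
    fix \<omega>
    have S5: "(\<Sum>k<5. f k) = f 0 + f 1 + f 2 + f 3 + f 4" for f :: "nat \<Rightarrow> real"
      by (simp add: eval_nat_numeral)
    have "(\<Sum>k<5. indicator G \<omega> * P k (Z \<omega>) * expectation (\<lambda>\<omega>. ?\<xi> \<omega> ^ k)) =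
      indicator G \<omega> * (P 0 (Z \<omega>) + P 2 (Z \<omega>) * \<eta> + \<kappa> * (3 * \<eta>\<^sup>2))"
      unfolding S5 power_0 power_one_right increment_moments[OF s] \<eta>_def
      by (simp add: P_def prob_space algebra_simps)
    also have "\<dots> = indicator G \<omega> * (c - e * (a * Z \<omega>) + q * (a\<^sup>2 * Z \<omega> ^ 2 + \<eta>)
      + \<kappa> * (a ^ 4 * Z \<omega> ^ 4 + 6 * a\<^sup>2 * \<eta> * Z \<omega> ^ 2 + 3 * \<eta>\<^sup>2))"
      by (simp add: P_def algebra_simps)
    finally show "(\<Sum>k<5. indicator G \<omega> * P k (Z \<omega>) * expectation (\<lambda>\<omega>. ?\<xi> \<omega> ^ k)) = \<dots>" .
  qed
  finally show ?thesis .
qed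

section \<open>The Gaussian law of the Euler scheme\<close>

definition "\<theta>max = Sup (\<theta> ` {0..T})"

lemma \<theta>_le: "s \<in> {0..T} \<Longrightarrow> \<theta> s \<le> \<theta>max"
  unfolding \<theta>max_def
  by (intro cSup_upper imageI bounded_imp_bdd_above compact_imp_bounded compact_continuous_image \<theta>_cont) auto

lemma \<theta>max_pos: "0 < \<theta>max"
  using \<theta>_le[of 0] \<theta>_pos[of 0] T_pos by simp

definition "eul t \<eta> i \<omega> = euler \<theta> t \<eta> (\<lambda>s. W s \<omega>) i"

definition "coef t \<eta> i = 1 - integral {t + real i * \<eta>..t + real (Suc i) * \<eta>} \<theta>"

text \<open>The variance of \<open>eul t \<eta> i\<close>: multiplication by the coefficient scales
  it by the square, and the independent increment adds \<open>\<eta>\<close>.\<close>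

fun evar :: "real \<Rightarrow> real \<Rightarrow> nat \<Rightarrow> real" where
  "evar t \<eta> 0 = 0"
| "evar t \<eta> (Suc i) = (coef t \<eta> i)\<^sup>2 * evar t \<eta> i + \<eta>"

lemma eul_0 [simp]: "eul t \<eta> 0 = (\<lambda>\<omega>. 0)"
  by (simp add: eul_def fun_eq_iff)

lemma eul_Suc: "eul t \<eta> (Suc i) \<omega> =
    coef t \<eta> i * eul t \<eta> i \<omega> + (W (t + real (Suc i) * \<eta>) \<omega> - W (t + real i * \<eta>) \<omega>)"
  by (simp add: eul_def coef_def)

lemma coef_bounds:
  assumes "0 \<le> t" "0 < \<eta>" "t + real (Suc i) * \<eta> \<le> T"
  shows "1 - \<theta>max * \<eta> \<le> coef t \<eta> i" "coef t \<eta> i \<le> 1"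
proof -
  let ?p = "t + real i * \<eta>" and ?q = "t + real (Suc i) * \<eta>"
  have pq: "0 \<le> ?p" "?p \<le> ?q" "?q \<le> T" "?q - ?p = \<eta>"
    using assms by (auto simp: algebra_simps)
  have sub: "{?p..?q} \<subseteq> {0..T}" using pq by auto
  have c: "continuous_on {?p..?q} \<theta>" by (rule continuous_on_subset[OF \<theta>_cont sub])
  have "0 \<le> integral {?p..?q} \<theta>"
    using \<theta>_pos sub by (intro Henstock_Kurzweil_Integration.integral_nonneg integrable_continuous_real c)
      (auto intro: less_imp_le)
  then show "coef t \<eta> i \<le> 1" by (simp add: coef_def)
  have "norm (integral {?p..?q} \<theta>) \<le> \<theta>max * (?q - ?p)"
  proof (rule integral_bound[OF pq(2) c])
    fix v assume "v \<in> {?p..?q}"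
    then have "v \<in> {0..T}" using sub by blast
    from \<theta>_pos[OF this] \<theta>_le[OF this] show "norm (\<theta> v) \<le> \<theta>max" by simp
  qed
  then show "1 - \<theta>max * \<eta> \<le> coef t \<eta> i" unfolding coef_def pq(4) by simp
qed

lemma grid_le:
  fixes \<eta> :: real
  assumes "0 < \<eta>" "i \<le> j" "t + real j * \<eta> \<le> T"
  shows "t + real i * \<eta> \<le> T"
proof -
  have "real i * \<eta> \<le> real j * \<eta>" using assms by (intro mult_right_mono) auto
  then show ?thesis using assms(3) by linarith
qed

lemma eul_measurable:
  assumes "0 \<le> t" "0 < \<eta>"
  shows "t + real i * \<eta> \<le> T \<Longrightarrow> eul t \<eta> i \<in> borel_measurable (F (t + real i * \<eta>))"
proof (induction i)
  case (Suc i)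
  have i: "t + real i * \<eta> \<le> T" using grid_le[OF assms(2) _ Suc.prems, of i] by simp
  have le: "t + real i * \<eta> \<le> t + real (Suc i) * \<eta>" using assms by (simp add: algebra_simps)
  have [measurable]: "eul t \<eta> i \<in> borel_measurable (F (t + real (Suc i) * \<eta>))"
    by (rule measurable_F_mono[OF le Suc.IH[OF i]])
  have [measurable]: "W (t + real i * \<eta>) \<in> borel_measurable (F (t + real (Suc i) * \<eta>))"
    using assms i le by (intro W_measurable_F) auto
  have [measurable]: "W (t + real (Suc i) * \<eta>) \<in> borel_measurable (F (t + real (Suc i) * \<eta>))"
    using assms Suc.prems by (intro W_measurable_F) auto
  show ?case unfolding eul_Suc[abs_def] by measurable
qed simp

text \<open>All coefficients lie in the unit interval, so the variance grows by at most
  \<open>\<eta>\<close> per step, as it would for Brownian motion.\<close>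

lemma evar_bounds:
  assumes "0 \<le> t" "0 < \<eta>" "\<theta>max * \<eta> \<le> 1"
  shows "t + real i * \<eta> \<le> T \<Longrightarrow> 0 \<le> evar t \<eta> i \<and> evar t \<eta> i \<le> real i * \<eta>"
proof (induction i)
  case (Suc i)
  have i: "0 \<le> evar t \<eta> i" "evar t \<eta> i \<le> real i * \<eta>"
    using Suc.IH[OF grid_le[OF assms(2) _ Suc.prems]] by auto
  note c = coef_bounds[OF assms(1,2) Suc.prems]
  have "0 \<le> coef t \<eta> i" using c assms by linarith
  then have "(coef t \<eta> i)\<^sup>2 \<le> 1" using c(2) by (simp add: power_le_one)
  then have "(coef t \<eta> i)\<^sup>2 * evar t \<eta> i \<le> 1 * evar t \<eta> i" by (rule mult_right_mono) (rule i)
  then show ?case using i assms by (auto simp: algebra_simps)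
qed simp

lemma evar_Suc_pos:
  assumes "0 \<le> t" "0 < \<eta>" "\<theta>max * \<eta> \<le> 1" "t + real (Suc i) * \<eta> \<le> T"
  shows "0 < evar t \<eta> (Suc i)"
  using evar_bounds[OF assms(1-3) grid_le[OF assms(2) _ assms(4), of i]] assms(2)
  by (auto intro!: add_nonneg_pos)

text \<open>A step adds \<open>\<eta>\<close> and loses at most
  \<open>2 * \<theta>max * \<eta> * evar t \<eta> i\<close>. As \<open>evar t \<eta> i\<close> is at
  most \<open>real n * \<eta>\<close>, the bound 1/4 limits this loss to \<open>\<eta> / 2\<close>,
  which leaves a net growth of at least \<open>\<eta> / 2\<close>.\<close>

lemma evar_lower:
  assumes "0 \<le> t" "0 < \<eta>" and n: "t + real n * \<eta> \<le> T" "\<theta>max * (real n * \<eta>) \<le> 1/4"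
  shows "i \<le> n \<Longrightarrow> real i * \<eta> / 2 \<le> evar t \<eta> i"
proof (induction i)
  case (Suc i)
  have i: "t + real (Suc i) * \<eta> \<le> T" "t + real i * \<eta> \<le> T"
    using grid_le[OF assms(2) _ n(1), of "Suc i"] grid_le[OF assms(2) _ n(1), of i] Suc.prems
    by (simp_all del: of_nat_Suc)
  have "\<eta> * 1 \<le> \<eta> * real n" using Suc.prems assms(2) by (intro mult_left_mono) auto
  then have "\<theta>max * \<eta> \<le> \<theta>max * (real n * \<eta>)"
    using \<theta>max_pos by (intro mult_left_mono) (auto simp: mult.commute)
  then have C\<eta>: "\<theta>max * \<eta> \<le> 1/4" using n by simp
  then have e: "0 \<le> evar t \<eta> i" "evar t \<eta> i \<le> real i * \<eta>"
    using evar_bounds[OF assms(1,2) _ i(2)] by auto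
  have "real i * \<eta> \<le> real n * \<eta>" using Suc.prems assms(2) by (intro mult_right_mono) auto
  then have "\<theta>max * evar t \<eta> i \<le> \<theta>max * (real n * \<eta>)"
    using e \<theta>max_pos by (intro mult_left_mono) auto
  then have Ce: "\<theta>max * evar t \<eta> i \<le> 1/4" using n by simp
  have "(1 - \<theta>max * \<eta>)\<^sup>2 \<le> (coef t \<eta> i)\<^sup>2"
    using coef_bounds[OF assms(1,2) i(1)] C\<eta> by (intro power_mono) auto
  moreover have "(1 - \<theta>max * \<eta>)\<^sup>2 = 1 - 2 * (\<theta>max * \<eta>) + (\<theta>max * \<eta>)\<^sup>2"
    by (simp add: power2_diff)
  ultimately have "1 - 2 * (\<theta>max * \<eta>) \<le> (coef t \<eta> i)\<^sup>2"
    using zero_le_power2[of "\<theta>max * \<eta>"] by linarith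
  then have "(1 - 2 * (\<theta>max * \<eta>)) * evar t \<eta> i \<le> (coef t \<eta> i)\<^sup>2 * evar t \<eta> i"
    by (rule mult_right_mono) (rule e)
  moreover have "(\<theta>max * evar t \<eta> i) * \<eta> \<le> (1/4) * \<eta>" using Ce assms(2) by (intro mult_right_mono) auto
  moreover have "real i * \<eta> / 2 \<le> evar t \<eta> i" using Suc.IH Suc.prems by simp
  moreover have "(1 - 2 * (\<theta>max * \<eta>)) * evar t \<eta> i = evar t \<eta> i - 2 * ((\<theta>max * evar t \<eta> i) * \<eta>)"
    by (simp add: algebra_simps)
  moreover have "real (Suc i) * \<eta> / 2 = real i * \<eta> / 2 + \<eta> / 2" by (simp add: algebra_simps)
  ultimately show ?case unfolding evar.simps by linarith
qed simp

text \<open>The new increment is independent of the past, so each step adds independent centred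
  normals. The index starts at \<open>Suc i\<close> because step 0 has variance zero and hence no
  density; \<open>\<theta>max * \<eta> < 1\<close> keeps the coefficients positive.\<close>

lemma eul_normal:
  assumes "0 \<le> t" "0 < \<eta>" "\<theta>max * \<eta> < 1"
  shows "t + real (Suc i) * \<eta> \<le> T \<Longrightarrow>
    distributed M lborel (eul t \<eta> (Suc i)) (normal_density 0 (sqrt (evar t \<eta> (Suc i))))"
proof (induction i)
  case 0
  have "distributed M lborel (\<lambda>\<omega>. W (t + \<eta>) \<omega> - W t \<omega>) (normal_density 0 (sqrt (t + \<eta> - t)))"
    using assms 0 by (intro increment_normal) auto
  then show ?case by (simp add: eul_Suc[abs_def])
next
  case (Suc i)
  let ?p = "t + real (Suc i) * \<eta>" and ?q = "t + real (Suc (Suc i)) * \<eta>"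
  let ?a = "coef t \<eta> (Suc i)" and ?v = "evar t \<eta> (Suc i)"
  have p: "?p \<le> T" using grid_le[OF assms(2) _ Suc.prems, of "Suc i"] by simp
  have pq: "0 \<le> ?p" "?p < ?q" "?q \<le> T" "?q - ?p = \<eta>"
    using assms Suc.prems by (auto simp: algebra_simps)
  have a: "0 < ?a" using coef_bounds(1)[OF assms(1,2) Suc.prems] assms by linarith
  have v: "0 < ?v" by (rule evar_Suc_pos[OF assms(1,2) _ p]) (use assms in auto)
  have "distributed M lborel (\<lambda>\<omega>. 0 + ?a * eul t \<eta> (Suc i) \<omega>) (normal_density (0 + ?a * 0) (\<bar>?a\<bar> * sqrt ?v))"
    using a v by (intro normal_density_affine Suc.IH[OF p]) auto
  then have 1: "distributed M lborel (\<lambda>\<omega>. ?a * eul t \<eta> (Suc i) \<omega>) (normal_density 0 (?a * sqrt ?v))"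
    using a by simp
  have 2: "distributed M lborel (\<lambda>\<omega>. W ?q \<omega> - W ?p \<omega>) (normal_density 0 (sqrt \<eta>))"
    using increment_normal[OF pq(1-3)] unfolding pq(4) .
  have "(\<lambda>\<omega>. ?a * eul t \<eta> (Suc i) \<omega>) \<in> borel_measurable (F ?p)"
    using eul_measurable[OF assms(1,2) p] by measurable
  then have ind: "indep_var borel (\<lambda>\<omega>. ?a * eul t \<eta> (Suc i) \<omega>) borel (\<lambda>\<omega>. W ?q \<omega> - W ?p \<omega>)"
    by (rule increment_indep[OF pq(1-3)])
  have "distributed M lborel (\<lambda>\<omega>. ?a * eul t \<eta> (Suc i) \<omega> + (W ?q \<omega> - W ?p \<omega>))
      (normal_density (0 + 0) (sqrt ((?a * sqrt ?v)\<^sup>2 + (sqrt \<eta>)\<^sup>2)))"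
    by (rule add_indep_normal[OF ind _ _ 1 2]) (use a v assms in auto)
  moreover have "(?a * sqrt ?v)\<^sup>2 + (sqrt \<eta>)\<^sup>2 = evar t \<eta> (Suc (Suc i))"
    unfolding evar.simps(2)[of t \<eta> "Suc i"] using v assms
    by (simp add: power_mult_distrib del: evar.simps)
  ultimately show ?case unfolding eul_Suc[of t \<eta> "Suc i", abs_def] by (simp del: evar.simps)
qed

lemma eul_integrable_power:
  assumes "0 \<le> t" "0 < \<eta>" "\<theta>max * \<eta> < 1" "t + real i * \<eta> \<le> T"
  shows "integrable M (\<lambda>\<omega>. eul t \<eta> i \<omega> ^ k)"
proof (cases i)
  case (Suc j)
  show ?thesis unfolding Suc
    by (rule centered_normal_integrable_power[OF _ eul_normal[OF assms(1-3)]])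
      (use evar_Suc_pos[OF assms(1,2)] assms Suc in auto)
qed simp

end

subsection \<open>The Ornstein--Uhlenbeck flow\<close>

text \<open>\<open>k n\<close> is the first grid index whose time is not before \<open>r\<close>.
  Rounding up is essential: by the last claim the event \<open>k n \<le> i\<close> is decided by
  whether \<open>r\<close> has been reached at grid time \<open>i\<close>, so a rounded stopping
  time remains a stopping time.\<close>

lemma ceiling_grid:
  fixes r h :: real
  assumes "0 \<le> r" "r \<le> h" "0 < h"
  defines "k \<equiv> \<lambda>n. nat \<lceil>r * real n / h\<rceil>"
  shows "k n \<le> n" and "(\<lambda>n. t + real (k n) * (h / real n)) \<longlonglongrightarrow> t + r"
    and "0 < n \<Longrightarrow> k n \<le> i \<longleftrightarrow> r \<le> real i * (h / real n)"
proof -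
  have "r * real n \<le> h * real n" using assms by (intro mult_right_mono) auto
  then have "r * real n / h \<le> real n" using assms by (simp add: field_simps)
  then show "k n \<le> n" unfolding k_def by (simp add: ceiling_le_iff)
  show iff: "k n \<le> i \<longleftrightarrow> r \<le> real i * (h / real n)" if "0 < n" for n i
    using that assms unfolding k_def by (simp add: ceiling_le_iff field_simps)
  have lo: "r \<le> real (k n) * (h / real n)" if "0 < n" for n
    using iff[OF that, of "k n"] by simp
  have up: "real (k n) * (h / real n) \<le> r + h / real n" if "0 < n" for n
  proof -
    have "real (k n) \<le> r * real n / h + 1"
      unfolding k_def using assms of_int_ceiling_le_add_one[of "r * real n / h"] by simp
    then have "real (k n) * (h / real n) \<le> (r * real n / h + 1) * (h / real n)"
      using assms by (intro mult_right_mono) auto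
    also have "\<dots> = r + h / real n" using that assms by (simp add: field_simps)
    finally show ?thesis .
  qed
  have "(\<lambda>n. real (k n) * (h / real n)) \<longlonglongrightarrow> r"
  proof (rule tendsto_sandwich[of "\<lambda>_. r" _ _ "\<lambda>n. r + h / real n"])
    show "\<forall>\<^sub>F n in sequentially. r \<le> real (k n) * (h / real n)"
      using eventually_gt_at_top[of 0] by eventually_elim (rule lo)
    show "\<forall>\<^sub>F n in sequentially. real (k n) * (h / real n) \<le> r + h / real n"
      using eventually_gt_at_top[of 0] by eventually_elim (rule up)
    show "(\<lambda>n. r + h / real n) \<longlonglongrightarrow> r"
      using tendsto_add[OF tendsto_const lim_const_over_n, of r h] by simp
  qed simp
  then show "(\<lambda>n. t + real (k n) * (h / real n)) \<longlonglongrightarrow> t + r"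
    by (intro tendsto_add tendsto_const)
qed

context ou_stopping begin

definition "\<Theta> s = integral {0..s} \<theta>"

definition "drive s = integral {0..s} (\<lambda>u. \<theta> u * \<alpha> u * exp (\<Theta> u))"

text \<open>The variation of constants formula for the noiseless equation started from
  \<open>x\<close> at time \<open>t\<close>, with integrating factor
  \<open>exp (\<Theta> s)\<close>.\<close>

definition "mean t x s = exp (- \<Theta> s) * (x * exp (\<Theta> t) + drive s - drive t)"

text \<open>The random part of the solution. Its dependence on \<open>x\<close> is only formal:
  \<open>noise_indep_start\<close> removes it almost surely for \<open>t < T\<close>.\<close>

definition "noise t x s \<omega> = X t x s \<omega> - mean t x s"

lemma \<Theta>_deriv: "s \<in> {0..T} \<Longrightarrow> (\<Theta> has_real_derivative \<theta> s) (at s within {0..T})"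
  unfolding \<Theta>_def[abs_def] by (rule integral_has_real_derivative[OF \<theta>_cont])

lemma \<Theta>_cont: "continuous_on {0..T} \<Theta>"
  by (rule DERIV_continuous_on[OF \<Theta>_deriv])

lemma drive_deriv:
  "s \<in> {0..T} \<Longrightarrow> (drive has_real_derivative \<theta> s * \<alpha> s * exp (\<Theta> s)) (at s within {0..T})"
  unfolding drive_def[abs_def]
  by (rule integral_has_real_derivative) (intro continuous_intros \<theta>_cont \<alpha>_cont \<Theta>_cont)

lemma drive_cont: "continuous_on {0..T} drive"
  by (rule DERIV_continuous_on[OF drive_deriv])

lemma mean_self [simp]: "mean t x t = x"
  by (simp add: mean_def exp_minus)

lemma mean_shift: "mean t x s = mean t y s + (x - y) * exp (\<Theta> t - \<Theta> s)"
  by (simp add: mean_def exp_diff exp_minus field_simps)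

lemma mean_deriv:
  assumes "s \<in> {0..T}"
  shows "(mean t x has_real_derivative \<theta> s * (\<alpha> s - mean t x s)) (at s within {0..T})"
  unfolding mean_def[abs_def]
  by (rule derivative_eq_intros \<Theta>_deriv drive_deriv assms refl)+ (simp add: algebra_simps exp_minus)

lemma mean_cont: "continuous_on {0..T} (mean t x)"
  by (rule DERIV_continuous_on[OF mean_deriv])

lemma mean_integral:
  assumes "0 \<le> t" "t \<le> s" "s \<le> T"
  shows "integral {t..s} (\<lambda>u. \<theta> u * (\<alpha> u - mean t x u)) = mean t x s - x"
proof -
  have "((\<lambda>u. \<theta> u * (\<alpha> u - mean t x u)) has_integral (mean t x s - mean t x t)) {t..s}"
  proof (rule fundamental_theorem_of_calculus[OF assms(2)])
    fix u assume "u \<in> {t..s}"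
    then have "(mean t x has_real_derivative \<theta> u * (\<alpha> u - mean t x u)) (at u within {t..s})"
      using assms by (intro DERIV_subset[OF mean_deriv]) auto
    then show "(mean t x has_vector_derivative \<theta> u * (\<alpha> u - mean t x u)) (at u within {t..s})"
      by (simp add: has_real_derivative_iff_has_vector_derivative)
  qed
  then show ?thesis by (simp add: integral_unique)
qed

lemma \<Theta>_mono:
  assumes "0 \<le> s" "s \<le> u" "u \<le> T"
  shows "\<Theta> s \<le> \<Theta> u"
  unfolding \<Theta>_def
proof (rule integral_subset_le)
  have c: "continuous_on {0..v} \<theta>" if "v \<le> T" for v
    by (rule continuous_on_subset[OF \<theta>_cont]) (use that in auto)
  show "\<theta> integrable_on {0..s}" "\<theta> integrable_on {0..u}"
    using assms by (auto intro!: integrable_continuous_real c)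
  show "\<forall>x\<in>{0..u}. 0 \<le> \<theta> x"
    using \<theta>_pos assms by (auto intro!: less_imp_le)
qed (use assms in auto)

text \<open>Subtracting the integrated equation of \<open>mean\<close> cancels both \<open>x\<close>
  and \<open>\<alpha>\<close> and leaves the linear equation to which \<open>euler_tendsto\<close>
  applies.\<close>

lemma noise_equation:
  assumes t: "t \<in> {0..T}"
  shows "AE \<omega> in M. continuous_on {t..T} (\<lambda>s. noise t x s \<omega>) \<and>
    (\<forall>s\<in>{t..T}. noise t x s \<omega> = W s \<omega> - W t \<omega> - integral {t..s} (\<lambda>u. \<theta> u * noise t x u \<omega>))"
proof -
  have sub: "{t..T} \<subseteq> {0..T}" using t by auto
  note c\<theta> = continuous_on_subset[OF \<theta>_cont sub] and c\<alpha> = continuous_on_subset[OF \<alpha>_cont sub]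
    and cm = continuous_on_subset[OF mean_cont sub]
  have "AE \<omega> in M. continuous_on {t..T} (\<lambda>s. X t x s \<omega>)"
    and "AE \<omega> in M. \<forall>s\<in>{t..T}. X t x s \<omega> = x + integral {t..s} (\<lambda>u. \<theta> u * (\<alpha> u - X t x u \<omega>)) + (W s \<omega> - W t \<omega>)"
    using solution[OF t, of x] unfolding ou_strong_solution_def by auto
  then show ?thesis
  proof eventually_elim
    case (elim \<omega>)
    have cn: "continuous_on {t..T} (\<lambda>s. noise t x s \<omega>)"
      unfolding noise_def by (intro continuous_intros elim cm)
    have "noise t x s \<omega> = W s \<omega> - W t \<omega> - integral {t..s} (\<lambda>u. \<theta> u * noise t x u \<omega>)" if s: "s \<in> {t..T}" for s
    proof -
      have sub': "{t..s} \<subseteq> {t..T}" using s by auto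
      have 1: "(\<lambda>u. \<theta> u * (\<alpha> u - X t x u \<omega>)) integrable_on {t..s}"
        by (intro integrable_continuous_real continuous_on_subset[OF _ sub'] continuous_intros elim(1) c\<theta> c\<alpha>)
      have 2: "(\<lambda>u. \<theta> u * noise t x u \<omega>) integrable_on {t..s}"
        by (intro integrable_continuous_real continuous_on_subset[OF _ sub'] continuous_intros cn c\<theta>)
      have "mean t x s - x = integral {t..s} (\<lambda>u. \<theta> u * (\<alpha> u - mean t x u))"
        using mean_integral[of t s x] t s by auto
      also have "\<dots> = integral {t..s} (\<lambda>u. \<theta> u * (\<alpha> u - X t x u \<omega>) + \<theta> u * noise t x u \<omega>)"
        by (simp add: noise_def algebra_simps)
      also have "\<dots> = integral {t..s} (\<lambda>u. \<theta> u * (\<alpha> u - X t x u \<omega>)) + integral {t..s} (\<lambda>u. \<theta> u * noise t x u \<omega>)"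
        by (rule Henstock_Kurzweil_Integration.integral_add[OF 1 2])
      also have "integral {t..s} (\<lambda>u. \<theta> u * (\<alpha> u - X t x u \<omega>)) = X t x s \<omega> - x - (W s \<omega> - W t \<omega>)"
        using elim(2) s by fastforce
      finally show ?thesis unfolding noise_def[of t x s \<omega>] by linarith
    qed
    then show ?case using cn by blast
  qed
qed

text \<open>The quantifiers over \<open>k\<close> and \<open>s\<close> stand inside the almost sure
  statement. One null set thus serves all index sequences, including those that depend on
  \<open>\<omega>\<close> through a stopping time.\<close>

lemma eul_tendsto:
  assumes t: "0 \<le> t" "0 < h" "t + h \<le> T"
  shows "AE \<omega> in M. \<forall>k s. (\<forall>n. k n \<le> n) \<longrightarrow> (\<lambda>n. t + real (k n) * (h / real n)) \<longlonglongrightarrow> s \<longrightarrow>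
    (\<lambda>n. eul t (h / real n) (k n) \<omega>) \<longlonglongrightarrow> noise t x s \<omega>"
proof -
  have "t \<in> {0..T}" using t by auto
  from noise_equation[OF this, of x] show ?thesis
  proof eventually_elim
    case (elim \<omega>)
    have sub: "{t..t + h} \<subseteq> {t..T}" and sub0: "{t..t + h} \<subseteq> {0..T}" using t by auto
    show ?case
    proof (intro allI impI)
      fix k :: "nat \<Rightarrow> nat" and s
      assume k: "\<forall>n. k n \<le> n" "(\<lambda>n. t + real (k n) * (h / real n)) \<longlonglongrightarrow> s"
      show "(\<lambda>n. eul t (h / real n) (k n) \<omega>) \<longlonglongrightarrow> noise t x s \<omega>"
        unfolding eul_def
      proof (rule euler_tendsto[where Z = "\<lambda>s. noise t x s \<omega>" and C = \<theta>max and s = s, OF t(2)])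
        show "continuous_on {t..t + h} (\<lambda>s. noise t x s \<omega>)"
          using elim sub continuous_on_subset by blast
        show "noise t x s \<omega> = W s \<omega> - W t \<omega> - integral {t..s} (\<lambda>u. \<theta> u * noise t x u \<omega>)"
          if "s \<in> {t..t + h}" for s using elim sub that by blast
        show "continuous_on {t..t + h} \<theta>" by (rule continuous_on_subset[OF \<theta>_cont sub0])
        show "0 \<le> \<theta> s \<and> \<theta> s \<le> \<theta>max" if "s \<in> {t..t + h}" for s
          using \<theta>_le[of s] \<theta>_pos[of s] sub0 that by (auto intro: less_imp_le)
      qed (use k in auto)
    qed
  qed
qed

text \<open>Both processes are limits of the same Euler scheme, in whose definition the starting
  point does not occur. This replaces a Gronwall argument for pathwise uniqueness.\<close>

lemma noise_indep_start:
  assumes t: "0 \<le> t" "t < T"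
  shows "AE \<omega> in M. \<forall>s\<in>{t..T}. noise t x s \<omega> = noise t y s \<omega>"
proof -
  have h: "0 < T - t" "t + (T - t) \<le> T" using t by auto
  show ?thesis
    using eul_tendsto[OF t(1) h, of x] eul_tendsto[OF t(1) h, of y]
  proof eventually_elim
    case (elim \<omega>)
    show ?case
    proof
      fix s assume s: "s \<in> {t..T}"
      define k where "k n = nat \<lceil>(s - t) * real n / (T - t)\<rceil>" for n
      have st: "0 \<le> s - t" "s - t \<le> T - t" using s by auto
      note g = ceiling_grid[OF st h(1), folded k_def]
      have "(\<lambda>n. t + real (k n) * ((T - t) / real n)) \<longlonglongrightarrow> s" using g(2)[of t] by simp
      then show "noise t x s \<omega> = noise t y s \<omega>"
        using elim g(1) LIMSEQ_unique by blast
    qed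
  qed
qed

end

subsection \<open>A quartic supersolution\<close>

text \<open>The left side is the mean of the quartic after one step from the value \<open>z\<close>,
  the right side its present value. The decay \<open>K * \<eta>\<close> of the quadratic coefficient
  absorbs all terms \<open>\<eta> * z\<^sup>2\<close>: \<open>6 * \<kappa>\<close> from the quartic
  and \<open>C\<^sup>2 / (2 * \<delta>)\<close> from the change of the linear coefficient. One half
  of \<open>\<delta> * \<eta>\<close> pays for the constant in the second estimate; the other half
  pays for \<open>q' * \<eta>\<close> and \<open>3 * \<kappa> * \<eta>\<^sup>2\<close>, whence
  \<open>9 = 6 + 3\<close> in the condition on \<open>h\<close>.\<close>

lemma quartic_drift:
  fixes a c c' e e' q q' z h K :: real
  assumes a: "0 \<le> a" "a \<le> 1" and \<eta>: "0 \<le> \<eta>" "\<eta> \<le> h" and \<kappa>: "0 \<le> \<kappa>" and \<delta>: "0 < \<delta>"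
    and c: "c' \<le> c - \<delta> * \<eta>" and e: "0 \<le> e - e' * a" "e - e' * a \<le> C * \<eta>"
    and K: "K = 6 * \<kappa> + C\<^sup>2 / (2 * \<delta>)"
    and q: "q = q' + K * \<eta>" "0 \<le> q'" "q' \<le> K * h"
    and h: "(9 * \<kappa> + C\<^sup>2 / (2 * \<delta>)) * h \<le> \<delta> / 2"
  shows "c' - e' * (a * z) + q' * (a\<^sup>2 * z ^ 2 + \<eta>) + \<kappa> * (a ^ 4 * z ^ 4 + 6 * a\<^sup>2 * \<eta> * z ^ 2 + 3 * \<eta>\<^sup>2)
    \<le> c - e * z + q * z ^ 2 + \<kappa> * z ^ 4"
proof -
  define B where "B = C\<^sup>2 / (2 * \<delta>)"
  \<comment> \<open>Young's inequality, weighted so that the constant term is exactly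
    \<open>\<delta> / 2\<close>.\<close>
  have amgm: "C * \<bar>z\<bar> \<le> \<delta> / 2 + B * z\<^sup>2"
  proof -
    have "0 \<le> (\<delta> - C * \<bar>z\<bar>)\<^sup>2" by simp
    then have "2 * \<delta> * (C * \<bar>z\<bar>) \<le> \<delta>\<^sup>2 + C\<^sup>2 * z\<^sup>2"
      by (simp add: power2_diff power_mult_distrib)
    then show ?thesis using \<delta> by (simp add: B_def field_simps power2_eq_square)
  qed
  have "(e - e' * a) * z \<le> (e - e' * a) * \<bar>z\<bar>" using e by (intro mult_left_mono) auto
  also have "\<dots> \<le> C * \<eta> * \<bar>z\<bar>" using e by (intro mult_right_mono) auto
  also have "\<dots> = \<eta> * (C * \<bar>z\<bar>)" by simp
  also have "\<dots> \<le> \<eta> * (\<delta> / 2 + B * z\<^sup>2)" using amgm \<eta> by (intro mult_left_mono) auto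
  finally have 1: "e * z - e' * (a * z) \<le> \<eta> * \<delta> / 2 + B * (\<eta> * z\<^sup>2)" by (simp add: algebra_simps)
  have a2: "a\<^sup>2 \<le> 1" "a ^ 4 \<le> 1" using a by (auto intro: power_le_one)
  have 2: "q' * (a\<^sup>2 * z\<^sup>2) \<le> q' * z\<^sup>2"
    using a2 q(2) by (intro mult_left_mono mult_left_le_one_le) auto
  have 3: "q' * \<eta> \<le> K * h * \<eta>" using q \<eta> by (intro mult_right_mono) auto
  have 4: "\<kappa> * (a ^ 4 * z ^ 4) \<le> \<kappa> * z ^ 4"
    using a2 a \<kappa> by (intro mult_left_mono mult_left_le_one_le) auto
  have 5: "\<kappa> * (6 * a\<^sup>2 * \<eta> * z\<^sup>2) \<le> 6 * \<kappa> * (\<eta> * z\<^sup>2)"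
  proof -
    have "6 * \<kappa> * (a\<^sup>2 * (\<eta> * z\<^sup>2)) \<le> 6 * \<kappa> * (\<eta> * z\<^sup>2)"
      using a2 \<kappa> \<eta> by (intro mult_left_mono mult_left_le_one_le) auto
    then show ?thesis by (simp add: mult_ac)
  qed
  have "\<eta> * \<eta> \<le> h * \<eta>" using \<eta> by (intro mult_right_mono) auto
  then have 6: "\<kappa> * (3 * \<eta>\<^sup>2) \<le> 3 * \<kappa> * h * \<eta>"
    using mult_left_mono[of "\<eta> * \<eta>" "h * \<eta>" "3 * \<kappa>"] \<kappa> by (simp add: power2_eq_square mult_ac)
  have 7: "K * h * \<eta> + 3 * \<kappa> * h * \<eta> \<le> \<delta> * \<eta> / 2"
  proof -
    have "(9 * \<kappa> + B) * h * \<eta> \<le> \<delta> / 2 * \<eta>"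
      using h \<eta> unfolding B_def by (intro mult_right_mono) auto
    then show ?thesis unfolding K B_def[symmetric] by (simp add: algebra_simps)
  qed
  have 8: "q * z\<^sup>2 = q' * z\<^sup>2 + 6 * \<kappa> * (\<eta> * z\<^sup>2) + B * (\<eta> * z\<^sup>2)"
    unfolding q K B_def by (simp add: algebra_simps)
  have 9: "c' - e' * (a * z) + q' * (a\<^sup>2 * z ^ 2 + \<eta>) + \<kappa> * (a ^ 4 * z ^ 4 + 6 * a\<^sup>2 * \<eta> * z ^ 2 + 3 * \<eta>\<^sup>2)
    = c' - e' * (a * z) + q' * (a\<^sup>2 * z\<^sup>2) + q' * \<eta> + \<kappa> * (a ^ 4 * z ^ 4) + \<kappa> * (6 * a\<^sup>2 * \<eta> * z\<^sup>2) + \<kappa> * (3 * \<eta>\<^sup>2)"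
    by (simp add: distrib_left)
  have c2: "c' \<le> c - \<eta> * \<delta> / 2 - \<delta> * \<eta> / 2" using c by (simp add: mult.commute)
  show ?thesis unfolding 8 9 using 1 2 3 4 5 6 7 c2 by linarith
qed

text \<open>The gain is a linear function plus the excess beyond the kink. The excess vanishes
  unless \<open>z > D \<ge> d\<close>; there it is at most \<open>z\<close>, and
  \<open>z / d \<ge> 1\<close> gives \<open>z \<le> z * (z / d) ^ 3\<close>.\<close>

lemma excess_le_quartic:
  fixes z D d :: real
  assumes "0 < d" "d \<le> D"
  shows "max (D - z) 0 \<le> D - z + max (z - D) 0" "max (z - D) 0 \<le> 1 / d ^ 3 * z ^ 4"
proof -
  show "max (D - z) 0 \<le> D - z + max (z - D) 0" by auto
  show "max (z - D) 0 \<le> 1 / d ^ 3 * z ^ 4"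
  proof (cases "z \<le> D")
    case True then show ?thesis using assms by auto
  next
    case False
    then have "d ^ 3 \<le> z ^ 3" using assms by (intro power_mono) auto
    then have "z * d ^ 3 \<le> z * z ^ 3" using False assms by (intro mult_left_mono) auto
    then have "z \<le> 1 / d ^ 3 * z ^ 4" using assms by (simp add: field_simps eval_nat_numeral)
    then show ?thesis using False assms by auto
  qed
qed

section \<open>Optional stopping on the grid and the upper bound for the value function\<close>

context ou_stopping begin

text \<open>Raising the cap from \<open>j\<close> to \<open>Suc j\<close> changes the stopped value
  only on the event \<open>N > j\<close>. This event lies in \<open>F (s j)\<close>, so the one-step
  inequality applies to it.\<close>

lemma stopped_supermartingale:
  fixes u :: "nat \<Rightarrow> 'a \<Rightarrow> real" and N :: "'a \<Rightarrow> nat"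
  assumes u: "\<And>i. i \<le> n \<Longrightarrow> integrable M (u i)"
    and N: "\<And>i. i < n \<Longrightarrow> {\<omega>\<in>space M. N \<omega> \<le> i} \<in> sets (F (s i))"
    and step: "\<And>i G. i < n \<Longrightarrow> G \<in> sets (F (s i)) \<Longrightarrow>
      expectation (\<lambda>\<omega>. indicator G \<omega> * u (Suc i) \<omega>) \<le> expectation (\<lambda>\<omega>. indicator G \<omega> * u i \<omega>)"
  shows "j \<le> n \<Longrightarrow> integrable M (\<lambda>\<omega>. u (min (N \<omega>) j) \<omega>) \<and>
    expectation (\<lambda>\<omega>. u (min (N \<omega>) j) \<omega>) \<le> expectation (u 0)"
proof (induction j)
  case 0
  then show ?case using u[of 0] by simp
next
  case (Suc j)
  define G where "G = space M - {\<omega>\<in>space M. N \<omega> \<le> j}"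
  have G: "G \<in> sets (F (s j))" unfolding G_def
    using sets.compl_sets[OF N[of j]] Suc.prems by simp
  then have GM: "G \<in> sets M" using sets_F_subset by blast
  have eq: "u (min (N \<omega>) (Suc j)) \<omega> =
      u (min (N \<omega>) j) \<omega> + (indicator G \<omega> * u (Suc j) \<omega> - indicator G \<omega> * u j \<omega>)" if "\<omega> \<in> space M" for \<omega>
    using that by (auto simp: G_def min_def indicator_def not_le le_Suc_eq)
  have i: "integrable M (\<lambda>\<omega>. indicator G \<omega> * u k \<omega>)" if "k \<le> n" for k
    using integrable_mult_indicator[OF GM u[OF that]] by simp
  have IH: "integrable M (\<lambda>\<omega>. u (min (N \<omega>) j) \<omega>)"
    "expectation (\<lambda>\<omega>. u (min (N \<omega>) j) \<omega>) \<le> expectation (u 0)"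
    using Suc by auto
  note i1 = i[of "Suc j"] and i0 = i[of j]
  have int: "integrable M (\<lambda>\<omega>. u (min (N \<omega>) j) \<omega> + (indicator G \<omega> * u (Suc j) \<omega> - indicator G \<omega> * u j \<omega>))"
    using IH(1) i1 i0 Suc.prems by auto
  have "integrable M (\<lambda>\<omega>. u (min (N \<omega>) (Suc j)) \<omega>)"
    using int by (subst Bochner_Integration.integrable_cong[OF refl eq])
  moreover have "expectation (\<lambda>\<omega>. u (min (N \<omega>) (Suc j)) \<omega>) =
      expectation (\<lambda>\<omega>. u (min (N \<omega>) j) \<omega> + (indicator G \<omega> * u (Suc j) \<omega> - indicator G \<omega> * u j \<omega>))"
    by (rule Bochner_Integration.integral_cong[OF refl eq])
  moreover have "\<dots> = expectation (\<lambda>\<omega>. u (min (N \<omega>) j) \<omega>) +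
      (expectation (\<lambda>\<omega>. indicator G \<omega> * u (Suc j) \<omega>) - expectation (\<lambda>\<omega>. indicator G \<omega> * u j \<omega>))"
    using IH(1) i1 i0 Suc.prems by simp
  ultimately show ?case using IH(2) step[of j G] G Suc.prems by linarith
qed

text \<open>The rate at which the discounted quantity \<open>A - mean t x s\<close> decreases: a
  positive value favours stopping. At \<open>s = t\<close> it is positive exactly when
  \<open>x\<close> lies below \<gamma>(t).\<close>

definition "drift t x s = exp (- \<rho> * (s - t)) * (\<theta> s * \<alpha> s + \<rho> * A - (\<theta> s + \<rho>) * mean t x s)"

lemma discounted_mean_deriv:
  assumes "s \<in> {0..T}"
  shows "((\<lambda>s. exp (- \<rho> * (s - t)) * (A - mean t x s)) has_real_derivative - drift t x s) (at s within {0..T})"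
  unfolding drift_def
  by (rule derivative_eq_intros mean_deriv assms refl)+ (simp add: algebra_simps)

lemma discounted_mean_decrease:
  assumes "0 \<le> p" "p \<le> q" "q \<le> T" and \<delta>: "\<And>s. s \<in> {p..q} \<Longrightarrow> \<delta> \<le> drift t x s"
  shows "exp (- \<rho> * (q - t)) * (A - mean t x q) \<le> exp (- \<rho> * (p - t)) * (A - mean t x p) - \<delta> * (q - p)"
proof -
  let ?f = "\<lambda>s. exp (- \<rho> * (s - t)) * (A - mean t x s)"
  have "\<exists>s\<in>{p..q}. ?f q - ?f p = - drift t x s * (q - p)"
  proof (rule mvt_very_simple[OF assms(2)])
    fix s assume s: "p \<le> s" "s \<le> q"
    have "(?f has_real_derivative - drift t x s) (at s within {p..q})"
      using s assms by (intro DERIV_subset[OF discounted_mean_deriv]) auto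
    then show "(?f has_derivative (*) (- drift t x s)) (at s within {p..q})"
      by (simp only: has_field_derivative_def)
  qed
  then obtain s where s: "s \<in> {p..q}" "?f q - ?f p = - drift t x s * (q - p)" by blast
  have "(q - p) * \<delta> \<le> (q - p) * drift t x s" using \<delta>[OF s(1)] assms by (intro mult_left_mono) auto
  then show ?thesis using s(2) by (simp add: algebra_simps)
qed

text \<open>Along the scheme the function \<open>U\<close> of the overview dominates the discounted
  gain and is a supermartingale, so stopping by any grid rule \<open>N\<close> earns at most its
  initial value \<open>A - x\<close>.\<close>

lemma euler_quartic_supermartingale:
  fixes t x d \<delta> :: real and n :: nat
  assumes t: "0 \<le> t" "t < T" and d: "0 < d" and \<delta>: "0 < \<delta>"
    and D: "\<And>s. s \<in> {t..T} \<Longrightarrow> d \<le> A - mean t x s"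
    and dr: "\<And>s. s \<in> {t..T} \<Longrightarrow> \<delta> \<le> drift t x s"
    and h: "(9 * (1 / d ^ 3) + (\<rho> + \<theta>max)\<^sup>2 / (2 * \<delta>)) * (T - t) \<le> \<delta> / 2"
    and n: "0 < n" "\<theta>max * ((T - t) / real n) < 1"
    and N: "\<And>\<omega>. N \<omega> \<le> n"
      "\<And>i. i < n \<Longrightarrow> {\<omega>\<in>space M. N \<omega> \<le> i} \<in> sets (F (t + real i * ((T - t) / real n)))"
  shows "(\<integral>\<^sup>+\<omega>. ennreal (exp (- \<rho> * (real (N \<omega>) * ((T - t) / real n)))
      * gain A (mean t x (t + real (N \<omega>) * ((T - t) / real n)) + eul t ((T - t) / real n) (N \<omega>) \<omega>)) \<partial>M)
    \<le> ennreal (A - x)"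
proof -
  define h where "h = T - t"
  define \<eta> where "\<eta> = (T - t) / real n"
  \<comment> \<open>\<open>\<kappa>\<close> is the constant of \<open>excess_le_quartic\<close>.
    \<open>C\<close> bounds the relative rate of decay of the linear coefficient, from discounting
    (\<open>\<rho>\<close>) and mean reversion (\<open>\<theta>max\<close>). \<open>K\<close> is the
    decay rate required by \<open>quartic_drift\<close>, and \<open>q\<close> falls linearly to 0 at
    the horizon.\<close>
  define \<kappa> where "\<kappa> = 1 / d ^ 3"
  define C where "C = \<rho> + \<theta>max"
  define K where "K = 6 * \<kappa> + C\<^sup>2 / (2 * \<delta>)"
  define s where "s i = t + real i * \<eta>" for i
  define e where "e i = exp (- \<rho> * (real i * \<eta>))" for i
  define c where "c i = e i * (A - mean t x (s i))" for i
  define q where "q i = K * (h - real i * \<eta>)" for i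
  define U where "U i z = c i - e i * z + q i * z ^ 2 + \<kappa> * z ^ 4" for i z
  define u where "u i \<omega> = U i (eul t \<eta> i \<omega>)" for i \<omega>
  have \<eta>: "0 < \<eta>" "\<theta>max * \<eta> < 1" using n t by (auto simp: \<eta>_def)
  have n\<eta>: "real n * \<eta> = h" using n by (simp add: \<eta>_def h_def)
  have \<kappa>: "0 \<le> \<kappa>" using d by (simp add: \<kappa>_def)
  have K: "0 \<le> K" using \<kappa> \<delta> by (simp add: K_def)
  have i\<eta>: "real i * \<eta> \<le> h" if "i \<le> n" for i
    using mult_right_mono[of "real i" "real n" \<eta>] that \<eta> n\<eta> by simp
  have s: "s i \<in> {t..T}" if "i \<le> n" for i
    using i\<eta>[OF that] \<eta> by (auto simp: s_def h_def)
  have e: "0 < e i" "e i \<le> 1" for i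
    using \<rho>_nonneg \<eta> by (auto simp: e_def)
  have sT: "t + real i * \<eta> \<le> T" if "i \<le> n" for i using s[OF that] by (simp add: s_def)
  have q: "0 \<le> q i" if "i \<le> n" for i using K i\<eta>[OF that] by (simp add: q_def)
  \<comment> \<open>The excess beyond the kink is multiplied by \<open>e i \<le> 1\<close> and is
    then covered by the quartic term; the quadratic term is nonnegative and can be added.\<close>
  have dom: "e i * gain A (mean t x (s i) + z) \<le> U i z" if i: "i \<le> n" for i z
  proof -
    let ?D = "A - mean t x (s i)"
    note ex = excess_le_quartic[OF d D[OF s[OF i]], of z]
    have g: "gain A (mean t x (s i) + z) = max (?D - z) 0" by (simp add: gain_def algebra_simps)
    have "e i * gain A (mean t x (s i) + z) \<le> e i * (?D - z + max (z - ?D) 0)"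
      unfolding g using ex e[of i] by (intro mult_left_mono) auto
    also have "\<dots> = c i - e i * z + e i * max (z - ?D) 0" by (simp add: c_def algebra_simps)
    also have "e i * max (z - ?D) 0 \<le> 1 * max (z - ?D) 0" using e[of i] by (intro mult_right_mono) auto
    also have "\<dots> \<le> \<kappa> * z ^ 4" using ex by (simp add: \<kappa>_def)
    also have "c i - e i * z + \<kappa> * z ^ 4 \<le> U i z" using q[OF i] by (simp add: U_def)
    finally show ?thesis by simp
  qed
  have int_pow: "integrable M (\<lambda>\<omega>. eul t \<eta> i \<omega> ^ k)" if "i \<le> n" for i k
    by (rule eul_integrable_power[OF t(1) \<eta> sT[OF that]])
  have int_u: "integrable M (u i)" if "i \<le> n" for i
    unfolding u_def[abs_def] U_def using int_pow[OF that] int_pow[OF that, of 1] by auto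
  have step: "expectation (\<lambda>\<omega>. indicator G \<omega> * u (Suc i) \<omega>) \<le> expectation (\<lambda>\<omega>. indicator G \<omega> * u i \<omega>)"
    if i: "i < n" and G: "G \<in> sets (F (s i))" for i G
  proof -
    have i': "i \<le> n" "Suc i \<le> n" using i by auto
    have ss: "0 \<le> s i" "s i < s (Suc i)" "s (Suc i) \<le> T" "s (Suc i) - s i = \<eta>"
      using s[OF i'(1)] s[OF i'(2)] t \<eta> by (auto simp: s_def algebra_simps)
    define a where "a = coef t \<eta> i"
    have a: "1 - \<theta>max * \<eta> \<le> a" "a \<le> 1" "0 \<le> a"
      using coef_bounds[OF t(1) \<eta>(1) sT[OF i'(2)]] \<eta> by (auto simp: a_def)
    have GM: "G \<in> sets M" using G sets_F_subset by blast
    have eS: "e (Suc i) = e i * exp (- \<rho> * \<eta>)"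
      by (simp add: e_def exp_add[symmetric] algebra_simps)
    have ex: "1 - \<rho> * \<eta> \<le> exp (- \<rho> * \<eta>)" "exp (- \<rho> * \<eta>) \<le> 1" "0 < exp (- \<rho> * \<eta>)"
      using exp_ge_add_one_self[of "- \<rho> * \<eta>"] \<rho>_nonneg \<eta> by auto
    \<comment> \<open>The loss splits into \<open>1 - a \<le> \<theta>max * \<eta>\<close> and
      \<open>1 - exp (- \<rho> * \<eta>) \<le> \<rho> * \<eta>\<close>.\<close>
    have ee: "0 \<le> e i - e (Suc i) * a" "e i - e (Suc i) * a \<le> C * \<eta>"
    proof -
      have eq: "e i - e (Suc i) * a = e i * (1 - a * exp (- \<rho> * \<eta>))" by (simp add: eS algebra_simps)
      have "a * exp (- \<rho> * \<eta>) \<le> 1" using a ex by (intro mult_le_one) auto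
      then have pos: "0 \<le> 1 - a * exp (- \<rho> * \<eta>)" by simp
      then show "0 \<le> e i - e (Suc i) * a" unfolding eq using e[of i] by (intro mult_nonneg_nonneg) auto
      have "e i - e (Suc i) * a \<le> 1 * (1 - a * exp (- \<rho> * \<eta>))"
        unfolding eq using e[of i] pos by (intro mult_right_mono) auto
      also have "\<dots> = (1 - a) + a * (1 - exp (- \<rho> * \<eta>))" by (simp add: algebra_simps)
      also have "a * (1 - exp (- \<rho> * \<eta>)) \<le> 1 * (\<rho> * \<eta>)"
        using a ex by (intro mult_mono) auto
      finally show "e i - e (Suc i) * a \<le> C * \<eta>" using a by (simp add: C_def algebra_simps)
    qed
    have cc: "c (Suc i) \<le> c i - \<delta> * \<eta>"
    proof -
      have "exp (- \<rho> * (s (Suc i) - t)) * (A - mean t x (s (Suc i)))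
        \<le> exp (- \<rho> * (s i - t)) * (A - mean t x (s i)) - \<delta> * (s (Suc i) - s i)"
        using ss s[OF i'(1)] by (intro discounted_mean_decrease dr) auto
      from this[unfolded ss(4)] show ?thesis by (simp add: c_def e_def s_def)
    qed
    have qq: "q i = q (Suc i) + K * \<eta>" "q (Suc i) \<le> K * h"
      using K \<eta> by (simp_all add: q_def algebra_simps)
    have pw: "c (Suc i) - e (Suc i) * (a * z) + q (Suc i) * (a\<^sup>2 * z ^ 2 + \<eta>)
        + \<kappa> * (a ^ 4 * z ^ 4 + 6 * a\<^sup>2 * \<eta> * z ^ 2 + 3 * \<eta>\<^sup>2) \<le> U i z" for z
      unfolding U_def
    proof (rule quartic_drift[OF a(3,2) _ _ \<kappa> \<delta> cc ee K_def qq(1) q[OF i'(2)] qq(2)])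
      show "\<eta> \<le> h" using i\<eta>[of 1] n by simp
      show "(9 * \<kappa> + C\<^sup>2 / (2 * \<delta>)) * h \<le> \<delta> / 2" using h unfolding \<kappa>_def C_def h_def .
    qed (use \<eta> in auto)
    have meas: "eul t \<eta> i \<in> borel_measurable (F (s i))"
      unfolding s_def by (rule eul_measurable[OF t(1) \<eta>(1) sT[OF i'(1)]])
    have euS: "eul t \<eta> (Suc i) \<omega> = a * eul t \<eta> i \<omega> + (W (s (Suc i)) \<omega> - W (s i) \<omega>)" for \<omega>
      unfolding eul_Suc a_def s_def ..
    have "expectation (\<lambda>\<omega>. indicator G \<omega> * u (Suc i) \<omega>) =
      expectation (\<lambda>\<omega>. indicator G \<omega> * (c (Suc i) - e (Suc i) * (a * eul t \<eta> i \<omega>)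
        + q (Suc i) * (a\<^sup>2 * eul t \<eta> i \<omega> ^ 2 + \<eta>)
        + \<kappa> * (a ^ 4 * eul t \<eta> i \<omega> ^ 4 + 6 * a\<^sup>2 * \<eta> * eul t \<eta> i \<omega> ^ 2 + 3 * \<eta>\<^sup>2)))"
      using quartic_increment_expectation[OF ss(1-3) G meas int_pow[OF i'(1)], of "c (Suc i)" "e (Suc i)" a "q (Suc i)" \<kappa>]
      unfolding ss(4) u_def U_def euS .
    also have "\<dots> \<le> expectation (\<lambda>\<omega>. indicator G \<omega> * u i \<omega>)"
    proof (rule integral_mono)
      have iG: "integrable M (\<lambda>\<omega>. indicator G \<omega> * f \<omega>)" if "integrable M f" for f :: "'a \<Rightarrow> real"
        using integrable_mult_indicator[OF GM that] by simp
      show "integrable M (\<lambda>\<omega>. indicator G \<omega> * u i \<omega>)" by (rule iG[OF int_u[OF i'(1)]])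
      show "integrable M (\<lambda>\<omega>. indicator G \<omega> * (c (Suc i) - e (Suc i) * (a * eul t \<eta> i \<omega>)
        + q (Suc i) * (a\<^sup>2 * eul t \<eta> i \<omega> ^ 2 + \<eta>)
        + \<kappa> * (a ^ 4 * eul t \<eta> i \<omega> ^ 4 + 6 * a\<^sup>2 * \<eta> * eul t \<eta> i \<omega> ^ 2 + 3 * \<eta>\<^sup>2)))"
        using int_pow[OF i'(1)] int_pow[OF i'(1), of 1] by (intro iG) auto
      show "indicator G \<omega> * (c (Suc i) - e (Suc i) * (a * eul t \<eta> i \<omega>)
        + q (Suc i) * (a\<^sup>2 * eul t \<eta> i \<omega> ^ 2 + \<eta>)
        + \<kappa> * (a ^ 4 * eul t \<eta> i \<omega> ^ 4 + 6 * a\<^sup>2 * \<eta> * eul t \<eta> i \<omega> ^ 2 + 3 * \<eta>\<^sup>2)) \<le> indicator G \<omega> * u i \<omega>" for \<omega>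
        unfolding u_def by (intro mult_left_mono pw) auto
    qed
    finally show ?thesis .
  qed
  have min_N: "min (N \<omega>) n = N \<omega>" for \<omega> using N(1)[of \<omega>] by simp
  have N': "{\<omega>\<in>space M. N \<omega> \<le> i} \<in> sets (F (s i))" if "i < n" for i
    using N(2)[OF that] by (simp add: s_def \<eta>_def)
  have st: "integrable M (\<lambda>\<omega>. u (N \<omega>) \<omega>)" "expectation (\<lambda>\<omega>. u (N \<omega>) \<omega>) \<le> expectation (u 0)"
  proof -
    have "integrable M (\<lambda>\<omega>. u (min (N \<omega>) n) \<omega>) \<and> expectation (\<lambda>\<omega>. u (min (N \<omega>) n) \<omega>) \<le> expectation (u 0)"
      by (rule stopped_supermartingale[where n = n and s = s]) (assumption | rule int_u N' step order_refl)+
    then show "integrable M (\<lambda>\<omega>. u (N \<omega>) \<omega>)" "expectation (\<lambda>\<omega>. u (N \<omega>) \<omega>) \<le> expectation (u 0)"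
      unfolding min_N by blast+
  qed
  have dom': "exp (- \<rho> * (real (N \<omega>) * \<eta>)) * gain A (mean t x (t + real (N \<omega>) * \<eta>) + eul t \<eta> (N \<omega>) \<omega>) \<le> u (N \<omega>) \<omega>" for \<omega>
    using dom[OF N(1), of \<omega> "eul t \<eta> (N \<omega>) \<omega>"] unfolding u_def e_def s_def .
  have gain0: "0 \<le> gain A y" for y by (simp add: gain_def)
  have u0: "0 \<le> u (N \<omega>) \<omega>" for \<omega>
    using order_trans[OF mult_nonneg_nonneg[OF exp_ge_zero gain0] dom'] .
  have "(\<integral>\<^sup>+\<omega>. ennreal (exp (- \<rho> * (real (N \<omega>) * \<eta>)) * gain A (mean t x (t + real (N \<omega>) * \<eta>) + eul t \<eta> (N \<omega>) \<omega>)) \<partial>M)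
    \<le> (\<integral>\<^sup>+\<omega>. ennreal (u (N \<omega>) \<omega>) \<partial>M)"
    by (intro nn_integral_mono ennreal_leI dom')
  also have "\<dots> = ennreal (expectation (\<lambda>\<omega>. u (N \<omega>) \<omega>))"
    by (rule nn_integral_eq_integral[OF st(1)]) (simp add: u0)
  also have "\<dots> \<le> ennreal (A - x)"
  proof (rule ennreal_leI)
    \<comment> \<open>The scheme starts at 0, so every term of \<open>U\<close> but the constant
      vanishes, and \<open>c 0 = A - x\<close>.\<close>
    have "expectation (u 0) = A - x"
      unfolding u_def[abs_def] U_def by (simp add: c_def e_def s_def prob_space)
    then show "expectation (\<lambda>\<omega>. u (N \<omega>) \<omega>) \<le> A - x" using st(2) by simp
  qed
  finally show ?thesis unfolding \<eta>_def .
qed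

text \<open>Every admissible time is rounded up to the grid, where the bound \<open>A - x\<close>
  holds for all fine grids. The payoffs converge almost surely and are nonnegative, so Fatou's lemma
  carries the bound to the limit.\<close>

lemma value_le_of_drift:
  fixes t x d \<delta> :: real
  assumes t: "0 \<le> t" "t < T" and d: "0 < d" and \<delta>: "0 < \<delta>"
    and D: "\<And>s. s \<in> {t..T} \<Longrightarrow> d \<le> A - mean t x s"
    and dr: "\<And>s. s \<in> {t..T} \<Longrightarrow> \<delta> \<le> drift t x s"
    and h: "(9 * (1 / d ^ 3) + (\<rho> + \<theta>max)\<^sup>2 / (2 * \<delta>)) * (T - t) \<le> \<delta> / 2"
  shows "V t x \<le> ennreal (A - x)"
  unfolding value_function_def
proof (rule SUP_least)
  fix \<tau> assume "\<tau> \<in> admissible_times M T W t"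
  then have \<tau>: "\<And>\<omega>. \<omega> \<in> space M \<Longrightarrow> 0 \<le> \<tau> \<omega>" "\<And>\<omega>. \<omega> \<in> space M \<Longrightarrow> \<tau> \<omega> \<le> T - t"
    and st: "stopping_time F (\<lambda>\<omega>. t + \<tau> \<omega>)"
    by (auto simp: admissible_times_def)
  have hpos: "0 < T - t" using t by simp
  \<comment> \<open>Outside \<open>space M\<close> an admissible time is unconstrained; the value 0
    makes \<open>k n \<omega> \<le> n\<close> hold for every \<open>\<omega>\<close>.\<close>
  define k where "k n \<omega> = (if \<omega> \<in> space M then nat \<lceil>\<tau> \<omega> * real n / (T - t)\<rceil> else 0)" for n \<omega>
  have k_eq: "k n \<omega> = nat \<lceil>\<tau> \<omega> * real n / (T - t)\<rceil>" if "\<omega> \<in> space M" for n \<omega>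
    using that by (simp add: k_def)
  have k_le: "k n \<omega> \<le> n" for n \<omega>
    using ceiling_grid(1)[OF \<tau>(1,2) hpos, of \<omega> n] by (cases "\<omega> \<in> space M") (auto simp: k_def)
  have k_iff: "k n \<omega> \<le> i \<longleftrightarrow> \<tau> \<omega> \<le> real i * ((T - t) / real n)" if "\<omega> \<in> space M" "0 < n" for n i \<omega>
    unfolding k_eq[OF that(1)] by (rule ceiling_grid(3)[OF \<tau>(1,2) hpos]) (use that in auto)
  have k_lim: "(\<lambda>n. t + real (k n \<omega>) * ((T - t) / real n)) \<longlonglongrightarrow> t + \<tau> \<omega>" if "\<omega> \<in> space M" for \<omega>
    unfolding k_eq[OF that] by (rule ceiling_grid(2)[OF \<tau>(1,2) hpos]) (use that in auto)
  have k_sets: "{\<omega>\<in>space M. k n \<omega> \<le> i} \<in> sets (F (t + real i * ((T - t) / real n)))" if n: "0 < n" for n i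
  proof -
    have "{\<omega>\<in>space M. k n \<omega> \<le> i} = {\<omega>\<in>space M. t + \<tau> \<omega> \<le> t + real i * ((T - t) / real n)}"
      using k_iff[OF _ n] by auto
    then show ?thesis using stopping_timeD[OF st, of "t + real i * ((T - t) / real n)"]
      by (simp add: pred_def)
  qed
  define g where "g n \<omega> = ennreal (exp (- \<rho> * (real (k n \<omega>) * ((T - t) / real n)))
      * gain A (mean t x (t + real (k n \<omega>) * ((T - t) / real n)) + eul t ((T - t) / real n) (k n \<omega>) \<omega>))" for n \<omega>
  have grid: "t + real i * ((T - t) / real n) \<le> T" if "i \<le> n" for i n
  proof (cases "n = 0")
    case False
    have "real i * ((T - t) / real n) \<le> real n * ((T - t) / real n)"
      using that hpos by (intro mult_right_mono) auto
    then show ?thesis using False by simp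
  qed (use t in simp)
  \<comment> \<open>Indices \<open>Suc n\<close> avoid the degenerate grid with zero steps. The
    scheme is evaluated at a random index with finitely many values, so measurability reduces to
    that of each fixed index.\<close>
  have meas: "g (Suc n) \<in> borel_measurable M" for n
  proof -
    let ?\<eta> = "(T - t) / real (Suc n)"
    have le: "{\<omega>\<in>space M. k (Suc n) \<omega> \<le> i} \<in> sets M" for i
      using k_sets[of "Suc n" i] sets_F_subset by blast
    have km: "k (Suc n) \<in> measurable M (count_space {..Suc n})"
    proof (subst measurable_count_space_eq2, simp, intro conjI ballI)
      show "k (Suc n) \<in> space M \<rightarrow> {..Suc n}" using k_le[of "Suc n"] by auto
      fix a :: nat
      show "k (Suc n) -` {a} \<inter> space M \<in> sets M"
      proof (cases a)
        case 0
        then have "k (Suc n) -` {a} \<inter> space M = {\<omega>\<in>space M. k (Suc n) \<omega> \<le> 0}" by auto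
        then show ?thesis using le[of 0] by simp
      next
        case (Suc j)
        then have "k (Suc n) -` {a} \<inter> space M =
          {\<omega>\<in>space M. k (Suc n) \<omega> \<le> a} - {\<omega>\<in>space M. k (Suc n) \<omega> \<le> j}" by auto
        then show ?thesis using sets.Diff[OF le le, of a j] by simp
      qed
    qed
    have "(\<lambda>\<omega>. (\<lambda>i \<omega>. ennreal (exp (- \<rho> * (real i * ?\<eta>)) * gain A (mean t x (t + real i * ?\<eta>) + eul t ?\<eta> i \<omega>))) (k (Suc n) \<omega>) \<omega>)
        \<in> borel_measurable M"
    proof (rule measurable_compose_countable'[OF _ km])
      fix i assume "i \<in> {..Suc n}"
      then have [measurable]: "eul t ?\<eta> i \<in> borel_measurable M"
        using t by (intro measurable_F_M[OF eul_measurable] grid) auto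
      show "(\<lambda>\<omega>. ennreal (exp (- \<rho> * (real i * ?\<eta>)) * gain A (mean t x (t + real i * ?\<eta>) + eul t ?\<eta> i \<omega>))) \<in> borel_measurable M"
        unfolding gain_def by measurable
    qed simp
    then show ?thesis unfolding g_def[abs_def] by simp
  qed
  have lim: "AE \<omega> in M. (\<lambda>n. g (Suc n) \<omega>) \<longlonglongrightarrow> ennreal (exp (- \<rho> * \<tau> \<omega>) * gain A (X t x (t + \<tau> \<omega>) \<omega>))"
  proof -
    have "t + (T - t) \<le> T" by simp
    from eul_tendsto[OF t(1) hpos this, of x] AE_space show ?thesis
    proof eventually_elim
      case (elim \<omega>)
      note kl = k_lim[OF elim(2)]
      have 1: "(\<lambda>n. eul t ((T - t) / real n) (k n \<omega>) \<omega>) \<longlonglongrightarrow> noise t x (t + \<tau> \<omega>) \<omega>"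
        using elim(1)[rule_format, of "\<lambda>n. k n \<omega>", OF k_le kl] .
      have 2: "(\<lambda>n. mean t x (t + real (k n \<omega>) * ((T - t) / real n))) \<longlonglongrightarrow> mean t x (t + \<tau> \<omega>)"
      proof (rule continuous_on_tendsto_compose[OF mean_cont kl])
        show "t + \<tau> \<omega> \<in> {0..T}" using \<tau>[OF elim(2)] t by auto
        show "\<forall>\<^sub>F n in sequentially. t + real (k n \<omega>) * ((T - t) / real n) \<in> {0..T}"
          using grid[OF k_le] t by (intro always_eventually) auto
      qed
      have 3: "(\<lambda>n. real (k n \<omega>) * ((T - t) / real n)) \<longlonglongrightarrow> \<tau> \<omega>"
        using tendsto_diff[OF kl tendsto_const[of t]] by simp
      have "(\<lambda>n. g n \<omega>) \<longlonglongrightarrow> ennreal (exp (- \<rho> * \<tau> \<omega>) * gain A (mean t x (t + \<tau> \<omega>) + noise t x (t + \<tau> \<omega>) \<omega>))"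
        unfolding g_def gain_def by (intro tendsto_intros 1 2 3)
      then have "(\<lambda>n. g n \<omega>) \<longlonglongrightarrow> ennreal (exp (- \<rho> * \<tau> \<omega>) * gain A (X t x (t + \<tau> \<omega>) \<omega>))"
        by (simp add: noise_def)
      then show ?case by (rule LIMSEQ_Suc)
    qed
  qed
  \<comment> \<open>The payoff agrees almost everywhere with the lower limit of the grid payoffs,
    which is the form needed for Fatou's lemma.\<close>
  have "(\<integral>\<^sup>+\<omega>. ennreal (exp (- \<rho> * \<tau> \<omega>) * gain A (X t x (t + \<tau> \<omega>) \<omega>)) \<partial>M) = (\<integral>\<^sup>+\<omega>. liminf (\<lambda>n. g (Suc n) \<omega>) \<partial>M)"
  proof (rule nn_integral_cong_AE)
    show "AE \<omega> in M. ennreal (exp (- \<rho> * \<tau> \<omega>) * gain A (X t x (t + \<tau> \<omega>) \<omega>)) = liminf (\<lambda>n. g (Suc n) \<omega>)"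
      using lim
    proof eventually_elim
      case (elim \<omega>)
      show ?case by (rule lim_imp_Liminf[OF sequentially_bot elim, symmetric])
    qed
  qed
  also have "\<dots> \<le> liminf (\<lambda>n. \<integral>\<^sup>+\<omega>. g (Suc n) \<omega> \<partial>M)"
    by (rule nn_integral_liminf[OF meas])
  also have "\<dots> \<le> ennreal (A - x)"
  proof (rule Liminf_le[OF sequentially_bot])
    have "(\<lambda>n. (T - t) / real n) \<longlonglongrightarrow> 0" by (rule lim_const_over_n)
    then have "(\<lambda>n. \<theta>max * ((T - t) / real n)) \<longlonglongrightarrow> \<theta>max * 0" by (intro tendsto_mult tendsto_const)
    then have "(\<lambda>n. \<theta>max * ((T - t) / real (Suc n))) \<longlonglongrightarrow> 0"
      using LIMSEQ_Suc by fastforce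
    from order_tendstoD(2)[OF this, of 1]
    have "\<forall>\<^sub>F n in sequentially. \<theta>max * ((T - t) / real (Suc n)) < 1" by simp
    then show "\<forall>\<^sub>F n in sequentially. (\<integral>\<^sup>+\<omega>. g (Suc n) \<omega> \<partial>M) \<le> ennreal (A - x)"
    proof eventually_elim
      case (elim n)
      show ?case unfolding g_def
        by (rule euler_quartic_supermartingale[OF t d \<delta> D dr h _ elim]) (assumption | rule zero_less_Suc k_le k_sets)+
    qed
  qed
  finally show "(\<integral>\<^sup>+\<omega>. ennreal (exp (- \<rho> * \<tau> \<omega>) * gain A (X t x (t + \<tau> \<omega>) \<omega>)) \<partial>M) \<le> ennreal (A - x)" .
qed

end

subsection \<open>Elementary bounds for the value function\<close>

text \<open>No measurability of \<open>f\<close> is assumed, so \<open>nn_integral_add\<close> does not apply.\<close>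

lemma (in prob_space) nn_integral_add_const_le:
  assumes c: "c < top"
  shows "(\<integral>\<^sup>+\<omega>. f \<omega> + c \<partial>M) \<le> (\<integral>\<^sup>+\<omega>. f \<omega> \<partial>M) + c"
  unfolding nn_integral_def[of M "\<lambda>\<omega>. f \<omega> + c"]
proof (rule SUP_least)
  fix g assume "g \<in> {g. simple_function M g \<and> g \<le> (\<lambda>\<omega>. f \<omega> + c)}"
  then have g: "simple_function M g" "\<And>\<omega>. g \<omega> \<le> f \<omega> + c" by (auto simp: le_fun_def)
  have [measurable]: "g \<in> borel_measurable M" by (rule borel_measurable_simple_function[OF g(1)])
  have "integral\<^sup>S M g = (\<integral>\<^sup>+\<omega>. g \<omega> \<partial>M)" by (rule nn_integral_eq_simple_integral[OF g(1), symmetric])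
  \<comment> \<open>Truncated subtraction splits the measurable function \<open>g\<close>, so
    additivity is applied to \<open>g - c\<close> and \<open>c\<close>; the former lies below
    \<open>f\<close>.\<close>
  also have "\<dots> \<le> (\<integral>\<^sup>+\<omega>. (g \<omega> - c) + c \<partial>M)"
  proof (intro nn_integral_mono)
    show "g \<omega> \<le> (g \<omega> - c) + c" for \<omega>
      by (cases "c \<le> g \<omega>") (simp_all add: diff_add_cancel_ennreal add_increasing)
  qed
  also have "\<dots> = (\<integral>\<^sup>+\<omega>. g \<omega> - c \<partial>M) + c"
    by (subst nn_integral_add) (auto simp: emeasure_space_1)
  also have "\<dots> \<le> (\<integral>\<^sup>+\<omega>. f \<omega> \<partial>M) + c"
    using g(2) c by (intro add_right_mono nn_integral_mono) (auto simp: ennreal_minus_le_iff add.commute)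
  finally show "integral\<^sup>S M g \<le> (\<integral>\<^sup>+\<omega>. f \<omega> \<partial>M) + c" .
qed

context ou_stopping begin

lemma value_ge_deterministic:
  assumes "0 \<le> t" "0 \<le> h" "t + h \<le> T"
  shows "(\<integral>\<^sup>+\<omega>. ennreal (exp (- \<rho> * h) * gain A (X t x (t + h) \<omega>)) \<partial>M) \<le> V t x"
proof -
  have "(\<lambda>\<omega>. h) \<in> admissible_times M T W t"
    using assms by (auto simp: admissible_times_def stopping_time_const)
  then show ?thesis unfolding value_function_def by (rule SUP_upper)
qed

lemma AE_start:
  assumes "t \<in> {0..T}"
  shows "AE \<omega> in M. X t x t \<omega> = x"
  using noise_equation[OF assms, of x]
proof eventually_elim
  case (elim \<omega>)
  then have "noise t x t \<omega> = W t \<omega> - W t \<omega> - integral {t..t} (\<lambda>u. \<theta> u * noise t x u \<omega>)"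
    using assms by (meson atLeastAtMost_iff order_refl)
  then show ?case by (simp add: noise_def[of t x t])
qed

lemma integral_start:
  assumes "t \<in> {0..T}"
  shows "(\<integral>\<^sup>+\<omega>. ennreal (gain A (X t x t \<omega>)) \<partial>M) = ennreal (gain A x)"
proof -
  have "(\<integral>\<^sup>+\<omega>. ennreal (gain A (X t x t \<omega>)) \<partial>M) = (\<integral>\<^sup>+\<omega>. ennreal (gain A x) \<partial>M)"
  proof (rule nn_integral_cong_AE)
    show "AE \<omega> in M. ennreal (gain A (X t x t \<omega>)) = ennreal (gain A x)"
      using AE_start[OF assms, of x] by eventually_elim simp
  qed
  then show ?thesis by (simp add: emeasure_space_1)
qed

lemma value_ge_gain: "t \<in> {0..T} \<Longrightarrow> ennreal (gain A x) \<le> V t x"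
  using value_ge_deterministic[of t 0 x] integral_start[of t x] by simp

lemma value_horizon: "V T x = ennreal (gain A x)"
proof (rule antisym)
  show "V T x \<le> ennreal (gain A x)"
    unfolding value_function_def
  proof (rule SUP_least)
    fix \<tau> assume "\<tau> \<in> admissible_times M T W T"
    then have "\<tau> \<omega> = 0" if "\<omega> \<in> space M" for \<omega>
      using that by (force simp: admissible_times_def)
    then have "(\<integral>\<^sup>+\<omega>. ennreal (exp (- \<rho> * \<tau> \<omega>) * gain A (X T x (T + \<tau> \<omega>) \<omega>)) \<partial>M) =
      (\<integral>\<^sup>+\<omega>. ennreal (gain A (X T x T \<omega>)) \<partial>M)"
      by (intro nn_integral_cong) simp
    then show "(\<integral>\<^sup>+\<omega>. ennreal (exp (- \<rho> * \<tau> \<omega>) * gain A (X T x (T + \<tau> \<omega>) \<omega>)) \<partial>M) \<le> ennreal (gain A x)"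
      using integral_start[of T x] T_pos by simp
  qed
  show "ennreal (gain A x) \<le> V T x" using value_ge_gain[of T x] T_pos by simp
qed

section \<open>Comparison of solutions with different starting points\<close>

text \<open>The noises coincide, so the difference of the two solutions is the deterministic
  \<open>(x - y) * exp (\<Theta> t - \<Theta> s)\<close>, whose exponential factor is at most
  1.\<close>

lemma AE_shift:
  assumes t: "0 \<le> t" "t < T" and xy: "y \<le> x"
  shows "AE \<omega> in M. \<forall>s\<in>{t..T}. X t y s \<omega> \<le> X t x s \<omega> \<and> X t x s \<omega> \<le> X t y s \<omega> + (x - y)"
  using noise_indep_start[OF t, of x y]
proof eventually_elim
  case (elim \<omega>)
  show ?case
  proof
    fix s assume s: "s \<in> {t..T}"
    then have "noise t x s \<omega> = noise t y s \<omega>" using elim by blast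
    then have eq: "X t x s \<omega> = X t y s \<omega> + (x - y) * exp (\<Theta> t - \<Theta> s)"
      using mean_shift[of t x s y] by (simp add: noise_def)
    have "\<Theta> t - \<Theta> s \<le> 0" using \<Theta>_mono[of t s] s t by auto
    then have "exp (\<Theta> t - \<Theta> s) \<le> 1" by simp
    then have "(x - y) * exp (\<Theta> t - \<Theta> s) \<le> (x - y) * 1"
      using xy by (intro mult_left_mono) auto
    moreover have "0 \<le> (x - y) * exp (\<Theta> t - \<Theta> s)" using xy by simp
    ultimately show "X t y s \<omega> \<le> X t x s \<omega> \<and> X t x s \<omega> \<le> X t y s \<omega> + (x - y)" using eq by simp
  qed
qed

lemma value_antimono:
  assumes t: "0 \<le> t" "t < T" and xy: "y \<le> x"
  shows "V t x \<le> V t y"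
  unfolding value_function_def
proof (rule SUP_mono)
  fix \<tau> assume \<tau>: "\<tau> \<in> admissible_times M T W t"
  have "(\<integral>\<^sup>+\<omega>. ennreal (exp (- \<rho> * \<tau> \<omega>) * gain A (X t x (t + \<tau> \<omega>) \<omega>)) \<partial>M)
     \<le> (\<integral>\<^sup>+\<omega>. ennreal (exp (- \<rho> * \<tau> \<omega>) * gain A (X t y (t + \<tau> \<omega>) \<omega>)) \<partial>M)"
  proof (rule nn_integral_mono_AE)
    show "AE \<omega> in M. ennreal (exp (- \<rho> * \<tau> \<omega>) * gain A (X t x (t + \<tau> \<omega>) \<omega>))
        \<le> ennreal (exp (- \<rho> * \<tau> \<omega>) * gain A (X t y (t + \<tau> \<omega>) \<omega>))"
      using AE_shift[OF t xy] AE_space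
    proof eventually_elim
      case (elim \<omega>)
      have "t + \<tau> \<omega> \<in> {t..T}" using \<tau> elim(2) by (auto simp: admissible_times_def)
      then have "gain A (X t x (t + \<tau> \<omega>) \<omega>) \<le> gain A (X t y (t + \<tau> \<omega>) \<omega>)"
        using bspec[OF elim(1), of "t + \<tau> \<omega>"] by (auto simp: gain_def)
      then show ?case by (intro ennreal_leI mult_left_mono) auto
    qed
  qed
  then show "\<exists>\<tau>'\<in>admissible_times M T W t.
     (\<integral>\<^sup>+\<omega>. ennreal (exp (- \<rho> * \<tau> \<omega>) * gain A (X t x (t + \<tau> \<omega>) \<omega>)) \<partial>M)
     \<le> (\<integral>\<^sup>+\<omega>. ennreal (exp (- \<rho> * \<tau>' \<omega>) * gain A (X t y (t + \<tau>' \<omega>) \<omega>)) \<partial>M)"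
    using \<tau> by blast
qed

text \<open>The same stopping time is used from both starting points. The gain is 1-Lipschitz, the
  solutions differ by at most \<open>x - y\<close>, and the discount factor is at most 1.\<close>

lemma value_lipschitz:
  assumes t: "0 \<le> t" "t < T" and xy: "y \<le> x"
  shows "V t y \<le> V t x + ennreal (x - y)"
  unfolding value_function_def[of _ _ _ _ _ _ _ y]
proof (rule SUP_least)
  fix \<tau> assume \<tau>: "\<tau> \<in> admissible_times M T W t"
  have "(\<integral>\<^sup>+\<omega>. ennreal (exp (- \<rho> * \<tau> \<omega>) * gain A (X t y (t + \<tau> \<omega>) \<omega>)) \<partial>M)
     \<le> (\<integral>\<^sup>+\<omega>. ennreal (exp (- \<rho> * \<tau> \<omega>) * gain A (X t x (t + \<tau> \<omega>) \<omega>)) + ennreal (x - y) \<partial>M)"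
  proof (rule nn_integral_mono_AE)
    show "AE \<omega> in M. ennreal (exp (- \<rho> * \<tau> \<omega>) * gain A (X t y (t + \<tau> \<omega>) \<omega>))
        \<le> ennreal (exp (- \<rho> * \<tau> \<omega>) * gain A (X t x (t + \<tau> \<omega>) \<omega>)) + ennreal (x - y)"
      using AE_shift[OF t xy] AE_space
    proof eventually_elim
      case (elim \<omega>)
      have \<tau>0: "0 \<le> \<tau> \<omega>" "t + \<tau> \<omega> \<in> {t..T}" using \<tau> elim(2) by (auto simp: admissible_times_def)
      let ?e = "exp (- \<rho> * \<tau> \<omega>)"
      have e: "?e \<le> 1" using \<tau>0 \<rho>_nonneg by simp
      have g: "gain A (X t y (t + \<tau> \<omega>) \<omega>) \<le> gain A (X t x (t + \<tau> \<omega>) \<omega>) + (x - y)"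
        using bspec[OF elim(1) \<tau>0(2)] xy by (auto simp: gain_def)
      have "?e * gain A (X t y (t + \<tau> \<omega>) \<omega>) \<le> ?e * (gain A (X t x (t + \<tau> \<omega>) \<omega>) + (x - y))"
        using g by (intro mult_left_mono) auto
      also have "\<dots> \<le> ?e * gain A (X t x (t + \<tau> \<omega>) \<omega>) + (x - y)"
        using e xy mult_right_mono[of ?e 1 "x - y"] by (simp add: distrib_left)
      finally have "?e * gain A (X t y (t + \<tau> \<omega>) \<omega>) \<le> ?e * gain A (X t x (t + \<tau> \<omega>) \<omega>) + (x - y)" .
      then have "ennreal (?e * gain A (X t y (t + \<tau> \<omega>) \<omega>)) \<le> ennreal (?e * gain A (X t x (t + \<tau> \<omega>) \<omega>) + (x - y))"
        by (rule ennreal_leI)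
      also have "\<dots> = ennreal (?e * gain A (X t x (t + \<tau> \<omega>) \<omega>)) + ennreal (x - y)"
        using xy by (intro ennreal_plus) (auto simp: gain_def)
      finally show ?case .
    qed
  qed
  also have "\<dots> \<le> (\<integral>\<^sup>+\<omega>. ennreal (exp (- \<rho> * \<tau> \<omega>) * gain A (X t x (t + \<tau> \<omega>) \<omega>)) \<partial>M) + ennreal (x - y)"
    by (rule nn_integral_add_const_le) simp
  also have "\<dots> \<le> V t x + ennreal (x - y)"
    unfolding value_function_def using \<tau> by (intro add_right_mono SUP_upper)
  finally show "(\<integral>\<^sup>+\<omega>. ennreal (exp (- \<rho> * \<tau> \<omega>) * gain A (X t y (t + \<tau> \<omega>) \<omega>)) \<partial>M) \<le> V t x + ennreal (x - y)" .
qed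

lemma noise_measurable:
  assumes "0 \<le> t" "t \<le> s" "s \<le> T"
  shows "noise t x s \<in> borel_measurable M"
proof -
  have "X t x s \<in> borel_measurable (F s)"
    using solution[of t x] assms by (auto simp: ou_strong_solution_def)
  then have [measurable]: "X t x s \<in> borel_measurable M" by (rule measurable_F_M)
  show ?thesis unfolding noise_def[abs_def] by measurable
qed

text \<open>Transfers Gaussian estimates from the scheme to the noise by dominated convergence,
  without computing the law of the noise. This is why the gain is truncated below.\<close>

lemma expectation_noise_limit:
  assumes t: "0 \<le> t" "0 < h" "t + h \<le> T"
    and f: "continuous_on UNIV f" "\<And>z :: real. \<bar>f z :: real\<bar> \<le> B"
  shows "(\<lambda>n. expectation (\<lambda>\<omega>. f (eul t (h / real (Suc n)) (Suc n) \<omega>)))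
    \<longlonglongrightarrow> expectation (\<lambda>\<omega>. f (noise t x (t + h) \<omega>))"
proof (rule integral_dominated_convergence[where w = "\<lambda>_. B"])
  have [measurable]: "f \<in> borel_measurable borel" by (rule borel_measurable_continuous_onI[OF f(1)])
  have [measurable]: "noise t x (t + h) \<in> borel_measurable M" using t by (intro noise_measurable) auto
  show "(\<lambda>\<omega>. f (noise t x (t + h) \<omega>)) \<in> borel_measurable M" by measurable
  show "(\<lambda>\<omega>. f (eul t (h / real (Suc n)) (Suc n) \<omega>)) \<in> borel_measurable M" for n
  proof -
    have [measurable]: "eul t (h / real (Suc n)) (Suc n) \<in> borel_measurable M"
      using t by (intro measurable_F_M[OF eul_measurable]) auto
    show ?thesis by measurable
  qed
  show "AE \<omega> in M. (\<lambda>n. f (eul t (h / real (Suc n)) (Suc n) \<omega>)) \<longlonglongrightarrow> f (noise t x (t + h) \<omega>)"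
    using eul_tendsto[OF t, of x]
  proof eventually_elim
    case (elim \<omega>)
    have "(\<lambda>n. t + real n * (h / real n)) \<longlonglongrightarrow> t + h"
      by (rule tendsto_eventually) (use eventually_gt_at_top[of 0] in eventually_elim, simp)
    then have "(\<lambda>n. eul t (h / real n) n \<omega>) \<longlonglongrightarrow> noise t x (t + h) \<omega>"
      using elim[rule_format, of "\<lambda>n. n" "t + h"] by simp
    then have "(\<lambda>n. eul t (h / real (Suc n)) (Suc n) \<omega>) \<longlonglongrightarrow> noise t x (t + h) \<omega>"
      by (rule LIMSEQ_Suc)
    then show ?case
      by (intro continuous_on_tendsto_compose[OF f(1)]) auto
  qed
qed (use f(2) in auto)

subsection \<open>Strict lower bounds\<close>

text \<open>The point is that the bounds on the variance \<open>v\<close> do not depend on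
  \<open>n\<close>, so estimates derived from them survive the limit.\<close>

lemma eul_terminal_normal:
  assumes t: "0 \<le> t" "0 < h" "t + h \<le> T" and small: "\<theta>max * h \<le> 1/4"
  obtains v where "h / 2 \<le> v" "v \<le> h"
    "distributed M lborel (eul t (h / real (Suc n)) (Suc n)) (normal_density 0 (sqrt v))"
proof -
  let ?\<eta> = "h / real (Suc n)"
  have n\<eta>: "real (Suc n) * ?\<eta> = h" by (simp add: field_simps)
  have \<eta>: "0 < ?\<eta>" using t by simp
  have "?\<eta> \<le> h" using t by (simp add: field_simps)
  then have "\<theta>max * ?\<eta> \<le> \<theta>max * h" using \<theta>max_pos by (intro mult_left_mono) auto
  then have \<theta>\<eta>: "\<theta>max * ?\<eta> < 1" "\<theta>max * ?\<eta> \<le> 1" using small by linarith+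
  have gT: "t + real (Suc n) * ?\<eta> \<le> T" unfolding n\<eta> by (rule t)
  show ?thesis
  proof (rule that)
    show "h / 2 \<le> evar t ?\<eta> (Suc n)"
      using evar_lower[OF t(1) \<eta> gT _ order_refl] small unfolding n\<eta> by (simp del: evar.simps)
    show "evar t ?\<eta> (Suc n) \<le> h"
      using evar_bounds[OF t(1) \<eta> \<theta>\<eta>(2) gT] unfolding n\<eta> by simp
    show "distributed M lborel (eul t ?\<eta> (Suc n)) (normal_density 0 (sqrt (evar t ?\<eta> (Suc n))))"
      by (rule eul_normal[OF t(1) \<eta> \<theta>\<eta>(1) gT])
  qed
qed

text \<open>Taking expectations in \<open>y - y\<^sup>2 / R \<le> min R (max y 0)\<close> with
  \<open>y = c - Y \<omega>\<close>, whose first two moments are \<open>c\<close> and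
  \<open>c\<^sup>2 + v\<close>.\<close>

lemma normal_truncated_gain_mean:
  assumes D: "distributed M lborel Y (normal_density 0 (sqrt v))" and v: "0 < v" and R: "0 < R"
  shows "c - (c\<^sup>2 + v) / R \<le> expectation (\<lambda>\<omega>. min R (max (c - Y \<omega>) 0))"
proof -
  have sv: "0 < sqrt v" using v by simp
  have [measurable]: "Y \<in> borel_measurable M" using distributed_measurable[OF D] by simp
  note ip = centered_normal_integrable_power[OF sv D]
  have i1: "integrable M Y" using ip[of 1] by simp
  note m = centered_normal_moments[OF sv D]
  have "expectation (\<lambda>\<omega>. (c - c\<^sup>2 / R) + (2 * c / R - 1) * Y \<omega> - 1 / R * Y \<omega> ^ 2)
      = (c - c\<^sup>2 / R) + (2 * c / R - 1) * 0 - 1 / R * v"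
    using i1 ip[of 2] m v by (simp add: prob_space)
  also have "\<dots> = c - (c\<^sup>2 + v) / R" by (simp add: add_divide_distrib)
  finally have "c - (c\<^sup>2 + v) / R = expectation (\<lambda>\<omega>. (c - c\<^sup>2 / R) + (2 * c / R - 1) * Y \<omega> - 1 / R * Y \<omega> ^ 2)" ..
  also have "\<dots> \<le> expectation (\<lambda>\<omega>. min R (max (c - Y \<omega>) 0))"
  proof (rule integral_mono)
    show "integrable M (\<lambda>\<omega>. (c - c\<^sup>2 / R) + (2 * c / R - 1) * Y \<omega> - 1 / R * Y \<omega> ^ 2)"
      using i1 ip[of 2] by auto
    show "integrable M (\<lambda>\<omega>. min R (max (c - Y \<omega>) 0))"
      by (rule integrable_const_bound[where B = R]) (use R in auto)
    fix \<omega>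
    let ?y = "c - Y \<omega>"
    have eq: "(c - c\<^sup>2 / R) + (2 * c / R - 1) * Y \<omega> - 1 / R * Y \<omega> ^ 2 = ?y - ?y\<^sup>2 / R"
      using R by (simp add: field_simps power2_eq_square)
    have "?y - ?y\<^sup>2 / R \<le> min R (max ?y 0)"
    proof (cases "?y \<le> R")
      case True
      have "0 \<le> ?y\<^sup>2 / R" using R by simp
      then have "?y - ?y\<^sup>2 / R \<le> R" "?y - ?y\<^sup>2 / R \<le> max ?y 0" using True by linarith+
      then show ?thesis by simp
    next
      case False
      have "R * ?y \<le> ?y * ?y" using False R by (intro mult_right_mono) auto
      then have "?y \<le> ?y\<^sup>2 / R" using R by (simp add: field_simps power2_eq_square)
      then show ?thesis using R by (auto simp: min_def max_def)
    qed
    then show "(c - c\<^sup>2 / R) + (2 * c / R - 1) * Y \<omega> - 1 / R * Y \<omega> ^ 2 \<le> min R (max ?y 0)"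
      unfolding eq .
  qed
  finally show ?thesis .
qed

text \<open>On the interval from \<open>c - 2\<close> to \<open>c - 1\<close>, of length one, the
  truncated gain equals 1. The density there is at least the stated bound for every admissible
  \<open>v\<close>, since \<open>\<bar>y\<bar> \<le> \<bar>c\<bar> + 2\<close> and
  \<open>h \<le> 2 * v\<close>.\<close>

lemma normal_truncated_gain_pos:
  assumes D: "distributed M lborel Y (normal_density 0 (sqrt v))" and v: "h / 2 \<le> v" "v \<le> h" and h: "0 < h"
  shows "1 / sqrt (2 * pi * h) * exp (- (\<bar>c\<bar> + 2)\<^sup>2 / h) \<le> expectation (\<lambda>\<omega>. min 1 (max (c - Y \<omega>) 0))"
proof -
  define p where "p = 1 / sqrt (2 * pi * h) * exp (- (\<bar>c\<bar> + 2)\<^sup>2 / h)"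
  define f where "f y = min 1 (max (c - y) 0)" for y :: real
  have v0: "0 < v" using v h by simp
  have [measurable]: "Y \<in> borel_measurable M" using distributed_measurable[OF D] by simp
  have [measurable]: "f \<in> borel_measurable borel" unfolding f_def[abs_def] by measurable
  have int_f: "integrable M (\<lambda>\<omega>. f (Y \<omega>))"
    by (rule integrable_const_bound[where B = 1]) (auto simp: f_def)
  have p: "0 \<le> p" using h by (simp add: p_def)
  have "p = (\<integral>y. p * indicator {c - 2..c - 1} y \<partial>lborel)" by simp
  also have "\<dots> \<le> (\<integral>y. normal_density 0 (sqrt v) y * f y \<partial>lborel)"
  proof (rule integral_mono)
    show "integrable lborel (\<lambda>y. p * indicator {c - 2..c - 1} y)"
      by (intro integrable_mult_right integrable_real_indicator) auto
    show "integrable lborel (\<lambda>y. normal_density 0 (sqrt v) y * f y)"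
      using distributed_integrable[OF D, of f] int_f by simp
    fix y
    show "p * indicator {c - 2..c - 1} y \<le> normal_density 0 (sqrt v) y * f y"
    proof (cases "y \<in> {c - 2..c - 1}")
      case True
      have "y\<^sup>2 \<le> (\<bar>c\<bar> + 2)\<^sup>2"
        unfolding abs_le_square_iff[symmetric] using True by auto
      then have "y\<^sup>2 / (2 * v) \<le> (\<bar>c\<bar> + 2)\<^sup>2 / h"
        using v h by (intro frac_le) auto
      then have 1: "exp (- (\<bar>c\<bar> + 2)\<^sup>2 / h) \<le> exp (- y\<^sup>2 / (2 * v))" by simp
      have "1 / sqrt (2 * pi * h) \<le> 1 / sqrt (2 * pi * v)"
        using v v0 by (intro divide_left_mono) auto
      then have "p \<le> 1 / sqrt (2 * pi * v) * exp (- y\<^sup>2 / (2 * v))"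
        unfolding p_def using 1 v0 by (intro mult_mono) auto
      then have "p \<le> normal_density 0 (sqrt v) y" using v0 by (simp add: normal_density_def)
      moreover have "f y = 1" using True by (auto simp: f_def)
      ultimately show ?thesis using True by simp
    qed (simp add: f_def)
  qed
  also have "\<dots> = expectation (\<lambda>\<omega>. f (Y \<omega>))"
    by (rule distributed_integral[OF D]) auto
  finally show ?thesis unfolding p_def f_def .
qed

lemma gain_mean_noise: "gain A (X t x s \<omega>) = max ((A - mean t x s) - noise t x s \<omega>) 0"
  by (simp add: gain_def noise_def)

lemma truncated_gain_cont:
  "continuous_on UNIV (\<lambda>z :: real. min R (max (c - z) 0) :: real)"
  by (intro continuous_intros)

text \<open>After a short fixed time the Gaussian noise has carried the solution below
  \<open>A\<close> with positive probability; the lower bound \<open>p\<close> is uniform in the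
  grid and so holds in the limit.\<close>

lemma value_pos:
  assumes t: "0 \<le> t" "t < T"
  shows "0 < V t x"
proof -
  define h where "h = min (T - t) (1 / (4 * \<theta>max))"
  have h: "0 < h" "t + h \<le> T" using t \<theta>max_pos by (auto simp: h_def)
  have "\<theta>max * h \<le> \<theta>max * (1 / (4 * \<theta>max))" using \<theta>max_pos by (intro mult_left_mono) (auto simp: h_def)
  then have small: "\<theta>max * h \<le> 1/4" using \<theta>max_pos by simp
  define c where "c = A - mean t x (t + h)"
  define f where "f z = min 1 (max (c - z) 0)" for z :: real
  define p where "p = 1 / sqrt (2 * pi * h) * exp (- (\<bar>c\<bar> + 2)\<^sup>2 / h)"
  have p: "0 < p" using h by (simp add: p_def)
  have lim: "(\<lambda>n. expectation (\<lambda>\<omega>. f (eul t (h / real (Suc n)) (Suc n) \<omega>)))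
    \<longlonglongrightarrow> expectation (\<lambda>\<omega>. f (noise t x (t + h) \<omega>))"
    unfolding f_def by (rule expectation_noise_limit[OF t(1) h truncated_gain_cont, where B = 1]) auto
  have "p \<le> expectation (\<lambda>\<omega>. f (noise t x (t + h) \<omega>))"
  proof (rule LIMSEQ_le_const[OF lim], intro exI allI impI)
    fix n :: nat
    obtain v where v: "h / 2 \<le> v" "v \<le> h"
      "distributed M lborel (eul t (h / real (Suc n)) (Suc n)) (normal_density 0 (sqrt v))"
      by (rule eul_terminal_normal[OF t(1) h small])
    show "p \<le> expectation (\<lambda>\<omega>. f (eul t (h / real (Suc n)) (Suc n) \<omega>))"
      unfolding f_def p_def by (rule normal_truncated_gain_pos[OF v(3,1,2) h(1)])
  qed
  then have E: "expectation (\<lambda>\<omega>. f (noise t x (t + h) \<omega>)) \<noteq> 0" using p by simp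
  let ?I = "\<integral>\<^sup>+\<omega>. ennreal (exp (- \<rho> * h) * gain A (X t x (t + h) \<omega>)) \<partial>M"
  \<comment> \<open>A vanishing payoff integral would make the truncated gain vanish almost surely,
    against its positive expectation.\<close>
  have "?I \<noteq> 0"
  proof
    assume I: "?I = 0"
    have [measurable]: "noise t x (t + h) \<in> borel_measurable M" using t h by (intro noise_measurable) auto
    have "(\<lambda>\<omega>. ennreal (exp (- \<rho> * h) * gain A (X t x (t + h) \<omega>))) \<in> borel_measurable M"
      unfolding gain_mean_noise by measurable
    with I have "AE \<omega> in M. ennreal (exp (- \<rho> * h) * gain A (X t x (t + h) \<omega>)) = 0"
      by (subst (asm) nn_integral_0_iff_AE) auto
    then have "AE \<omega> in M. f (noise t x (t + h) \<omega>) = 0"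
    proof eventually_elim
      case (elim \<omega>)
      then have "exp (- \<rho> * h) * gain A (X t x (t + h) \<omega>) \<le> 0" by (simp add: ennreal_eq_0_iff)
      then have "gain A (X t x (t + h) \<omega>) \<le> 0" by (simp add: mult_le_0_iff)
      then show ?case unfolding gain_mean_noise f_def c_def by auto
    qed
    then have "expectation (\<lambda>\<omega>. f (noise t x (t + h) \<omega>)) = 0"
      by (rule integral_eq_zero_AE)
    then show False using E by simp
  qed
  then have "0 < ?I" by (simp add: zero_less_iff_neq_zero)
  also have "?I \<le> V t x" using t h by (intro value_ge_deterministic) auto
  finally show ?thesis .
qed

text \<open>Jensen's inequality for the convex gain at the fixed time \<open>t + h\<close>: for
  centred noise, the mean of the gain is at least \<open>c\<close>. It is obtained from the
  truncated gain by letting the level \<open>R\<close> grow.\<close>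

lemma value_ge_discounted_mean:
  assumes t: "0 \<le> t" and h: "0 < h" "t + h \<le> T" and small: "\<theta>max * h \<le> 1/4"
  shows "ennreal (exp (- \<rho> * h) * (A - mean t x (t + h))) \<le> V t x"
proof -
  define c where "c = A - mean t x (t + h)"
  let ?G = "\<integral>\<^sup>+\<omega>. ennreal (gain A (X t x (t + h) \<omega>)) \<partial>M"
  have [measurable]: "noise t x (t + h) \<in> borel_measurable M" using t h by (intro noise_measurable) auto
  have trunc: "ennreal (c - (c\<^sup>2 + h) / R) \<le> ?G" if R: "0 < R" for R
  proof -
    define f where "f z = min R (max (c - z) 0)" for z :: real
    have lim: "(\<lambda>n. expectation (\<lambda>\<omega>. f (eul t (h / real (Suc n)) (Suc n) \<omega>)))
      \<longlonglongrightarrow> expectation (\<lambda>\<omega>. f (noise t x (t + h) \<omega>))"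
      unfolding f_def by (rule expectation_noise_limit[OF t h truncated_gain_cont, where B = R]) (use R in auto)
    have "c - (c\<^sup>2 + h) / R \<le> expectation (\<lambda>\<omega>. f (noise t x (t + h) \<omega>))"
    proof (rule LIMSEQ_le_const[OF lim], intro exI allI impI)
      fix n :: nat
      obtain v where v: "h / 2 \<le> v" "v \<le> h"
        "distributed M lborel (eul t (h / real (Suc n)) (Suc n)) (normal_density 0 (sqrt v))"
        by (rule eul_terminal_normal[OF t(1) h small])
      have "c - (c\<^sup>2 + h) / R \<le> c - (c\<^sup>2 + v) / R" using v R by (simp add: divide_right_mono)
      also have "\<dots> \<le> expectation (\<lambda>\<omega>. f (eul t (h / real (Suc n)) (Suc n) \<omega>))"
        unfolding f_def by (rule normal_truncated_gain_mean[OF v(3) _ R]) (use v h in auto)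
      finally show "c - (c\<^sup>2 + h) / R \<le> expectation (\<lambda>\<omega>. f (eul t (h / real (Suc n)) (Suc n) \<omega>))" .
    qed
    then have "ennreal (c - (c\<^sup>2 + h) / R) \<le> ennreal (expectation (\<lambda>\<omega>. f (noise t x (t + h) \<omega>)))"
      by (rule ennreal_leI)
    also have "\<dots> = (\<integral>\<^sup>+\<omega>. ennreal (f (noise t x (t + h) \<omega>)) \<partial>M)"
    proof (rule nn_integral_eq_integral[symmetric])
      show "integrable M (\<lambda>\<omega>. f (noise t x (t + h) \<omega>))"
        unfolding f_def by (rule integrable_const_bound[where B = R]) (use R in auto)
    qed (use R in \<open>auto simp: f_def\<close>)
    also have "\<dots> \<le> ?G"
      unfolding gain_mean_noise f_def c_def by (intro nn_integral_mono ennreal_leI) auto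
    finally show ?thesis .
  qed
  have "ennreal c \<le> ?G"
  proof (rule ennreal_le_epsilon)
    fix \<epsilon> :: real assume \<epsilon>: "0 < \<epsilon>"
    have ch: "0 < c\<^sup>2 + h" using h by (simp add: add_nonneg_pos)
    \<comment> \<open>With the level \<open>R = (c\<^sup>2 + h) / \<epsilon>\<close> the truncation
      costs exactly \<open>\<epsilon>\<close>.\<close>
    have eq: "(c\<^sup>2 + h) / ((c\<^sup>2 + h) / \<epsilon>) = \<epsilon>" using \<epsilon> ch by simp
    have le: "ennreal (c - \<epsilon>) \<le> ?G" using trunc[of "(c\<^sup>2 + h) / \<epsilon>"] ch \<epsilon> unfolding eq by simp
    have "ennreal c \<le> ennreal (c - \<epsilon>) + ennreal \<epsilon>"
    proof (cases "\<epsilon> \<le> c")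
      case True
      then show ?thesis using \<epsilon> by (simp flip: ennreal_plus)
    next
      case False
      then have "ennreal c \<le> ennreal \<epsilon>" by (intro ennreal_leI) simp
      then show ?thesis by (simp add: add_increasing)
    qed
    also have "\<dots> \<le> ?G + ennreal \<epsilon>" using le by (rule add_right_mono)
    finally show "ennreal c \<le> ?G + ennreal \<epsilon>" .
  qed
  then have "ennreal (exp (- \<rho> * h)) * ennreal c \<le> ennreal (exp (- \<rho> * h)) * ?G" by (rule mult_left_mono) simp
  also have "\<dots> = (\<integral>\<^sup>+\<omega>. ennreal (exp (- \<rho> * h)) * ennreal (gain A (X t x (t + h) \<omega>)) \<partial>M)"
    unfolding gain_mean_noise by (rule nn_integral_cmult[symmetric]) measurable
  also have "\<dots> = (\<integral>\<^sup>+\<omega>. ennreal (exp (- \<rho> * h) * gain A (X t x (t + h) \<omega>)) \<partial>M)"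
    by (simp add: ennreal_mult')
  also have "\<dots> \<le> V t x" using t h by (intro value_ge_deterministic) auto
  finally show ?thesis by (simp add: ennreal_mult' c_def)
qed

text \<open>For \<open>x \<ge> A\<close> the gain is zero while the value is positive. For
  \<open>x < A\<close> above \<gamma>(t), the discounted quantity \<open>A - mean t x s\<close>
  increases strictly at \<open>s = t\<close>, and waiting a short fixed time earns at least its
  later value.\<close>

lemma value_gt_gain:
  assumes t: "0 \<le> t" "t < T" and x: "(\<theta> t * \<alpha> t + \<rho> * A) / (\<theta> t + \<rho>) < x"
  shows "ennreal (gain A x) < V t x"
proof (cases "x < A")
  case False
  then show ?thesis using value_pos[OF t, of x] by (simp add: gain_def)
next
  case True
  have tT: "t \<in> {0..T}" using t by auto
  have pos: "0 < \<theta> t + \<rho>" using \<theta>_pos[OF tT] \<rho>_nonneg by simp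
  have "0 < - drift t x t"
    using x pos by (simp add: drift_def field_simps)
  from has_real_derivative_pos_inc_right[OF discounted_mean_deriv[OF tT] this]
  obtain d where d: "0 < d" and inc: "\<And>h. 0 < h \<Longrightarrow> t + h \<in> {0..T} \<Longrightarrow> h < d \<Longrightarrow>
      exp (- \<rho> * (t - t)) * (A - mean t x t) < exp (- \<rho> * (t + h - t)) * (A - mean t x (t + h))"
    by blast
  \<comment> \<open>The three caps keep \<open>h\<close> strictly below \<open>d\<close>, within the
    horizon, and small enough for the variance bounds.\<close>
  define h where "h = min (d / 2) (min (T - t) (1 / (4 * \<theta>max)))"
  have h: "0 < h" "t + h \<le> T" "h < d" using t \<theta>max_pos d by (auto simp: h_def)
  have "\<theta>max * h \<le> \<theta>max * (1 / (4 * \<theta>max))" using \<theta>max_pos by (intro mult_left_mono) (auto simp: h_def)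
  then have small: "\<theta>max * h \<le> 1/4" using \<theta>max_pos by simp
  have "A - x < exp (- \<rho> * h) * (A - mean t x (t + h))" using inc[of h] h t by simp
  then have "ennreal (A - x) < ennreal (exp (- \<rho> * h) * (A - mean t x (t + h)))"
    using True by (intro ennreal_lessI) auto
  also have "\<dots> \<le> V t x" by (rule value_ge_discounted_mean[OF t(1) h(1,2) small])
  finally show ?thesis using True by (simp add: gain_def)
qed

end

subsection \<open>The stopping boundary\<close>

text \<open>On a compact interval \<open>g\<close> has a positive minimum. Used with starting point
  \<open>-L\<close>, for which both \<open>A - mean\<close> and \<open>drift\<close> are affine in
  \<open>L\<close> with positive slope.\<close>

lemma affine_family_lower_bound:
  fixes f g :: "real \<Rightarrow> real"
  assumes f: "continuous_on {a..b} f" and g: "continuous_on {a..b} g"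
    and pos: "\<And>s. s \<in> {a..b} \<Longrightarrow> 0 < g s"
  shows "\<exists>L0. \<forall>L\<ge>L0. \<forall>s\<in>{a..b}. m \<le> f s + L * g s"
proof (cases "a \<le> b")
  case True
  then have ne: "{a..b} \<noteq> {}" by simp
  obtain p where p: "p \<in> {a..b}" "\<And>s. s \<in> {a..b} \<Longrightarrow> f p \<le> f s"
    using continuous_attains_inf[OF compact_Icc ne f] by blast
  obtain r where r: "r \<in> {a..b}" "\<And>s. s \<in> {a..b} \<Longrightarrow> g r \<le> g s"
    using continuous_attains_inf[OF compact_Icc ne g] by blast
  have gr: "0 < g r" by (rule pos[OF r(1)])
  have "m \<le> f s + L * g s" if L: "max 0 ((m - f p) / g r) \<le> L" and s: "s \<in> {a..b}" for L s
  proof -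
    have "m - f p \<le> L * g r" using L gr by (simp add: pos_divide_le_eq)
    also have "\<dots> \<le> L * g s" using r(2)[OF s] L by (intro mult_left_mono) auto
    finally show ?thesis using p(2)[OF s] by linarith
  qed
  then show ?thesis by blast
qed auto

text \<open>Joint continuity at the corner bounds \<open>f (t, s)\<close> for all remaining times
  \<open>s\<close> at once, as soon as \<open>t\<close> is close to \<open>b\<close>.\<close>

lemma continuous_corner:
  fixes f :: "real \<times> real \<Rightarrow> real"
  assumes f: "continuous_on ({a..b} \<times> {a..b}) f" and ab: "a < b" and c: "c < f (b, b)"
  shows "\<forall>\<^sub>F t in at_left b. \<forall>s\<in>{t..b}. c < f (t, s)"
proof -
  have "(b, b) \<in> {a..b} \<times> {a..b}" "0 < f (b, b) - c" using ab c by auto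
  then obtain d where d: "0 < d"
    "\<And>p. p \<in> {a..b} \<times> {a..b} \<Longrightarrow> dist p (b, b) < d \<Longrightarrow> dist (f p) (f (b, b)) < f (b, b) - c"
    using f unfolding continuous_on_iff by metis
  have "c < f (t, s)" if t: "max a (b - d / 2) < t" "t < b" and s: "s \<in> {t..b}" for t s
  proof -
    have "dist (t, s) (b, b) \<le> \<bar>dist t b\<bar> + \<bar>dist s b\<bar>"
      unfolding dist_Pair_Pair by (rule sqrt_sum_squares_le_sum_abs)
    also have "\<dots> < d" using t s by (auto simp: dist_real_def)
    finally have "dist (f (t, s)) (f (b, b)) < f (b, b) - c" using t s by (intro d(2)) auto
    then show ?thesis by (auto simp: dist_real_def)
  qed
  then show ?thesis unfolding eventually_at_left_field using ab d(1)
    by (intro exI[of _ "max a (b - d / 2)"]) auto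
qed

section \<open>Time sections of the stopping set and their upper end points\<close>

context ou_stopping begin

definition "\<gamma>\<^sub>0 t = (\<theta> t * \<alpha> t + \<rho> * A) / (\<theta> t + \<rho>)"

definition "stop_section t = {x. V t x = ennreal (gain A x)}"

lemma stop_sectionI:
  assumes "t \<in> {0..T}" "x \<le> A" "V t x \<le> ennreal (A - x)"
  shows "x \<in> stop_section t"
  using assms value_ge_gain[OF assms(1), of x] by (auto simp: stop_section_def gain_def intro: antisym)

lemma stop_section_less:
  assumes t: "0 \<le> t" "t < T" and x: "x \<in> stop_section t"
  shows "x < A" "x \<le> \<gamma>\<^sub>0 t" "V t x = ennreal (A - x)"
proof -
  have V: "V t x = ennreal (gain A x)" using x by (simp add: stop_section_def)
  show "x < A"
    using value_pos[OF t, of x] V by (cases "x < A") (auto simp: gain_def)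
  then show "V t x = ennreal (A - x)" using V by (simp add: gain_def)
  show "x \<le> \<gamma>\<^sub>0 t"
    using value_gt_gain[OF t, of x] V by (force simp: \<gamma>\<^sub>0_def)
qed

text \<open>Below \<open>A\<close> the gain has slope -1, and the value cannot grow faster to the
  left because it is 1-Lipschitz; equality at \<open>x\<close> thus forces equality at every
  \<open>y \<le> x\<close>.\<close>

lemma stop_section_downward:
  assumes t: "0 \<le> t" "t < T" and x: "x \<in> stop_section t" and y: "y \<le> x"
  shows "y \<in> stop_section t"
proof (rule stop_sectionI)
  note l = stop_section_less[OF t x]
  show "t \<in> {0..T}" using t by auto
  show "y \<le> A" using l(1) y by simp
  have "V t y \<le> ennreal (A - x) + ennreal (x - y)"
    using value_lipschitz[OF t y] unfolding l(3) .
  also have "\<dots> = ennreal (A - y)" using l(1) y by (simp flip: ennreal_plus)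
  finally show "V t y \<le> ennreal (A - y)" .
qed

text \<open>This keeps the boundary from being minus infinity. The remaining time may be long, so
  the starting point \<open>-L\<close> is taken so low that the decrease rate
  \<open>\<delta>\<close> outweighs it.\<close>

lemma stop_section_nonempty:
  assumes t: "0 \<le> t" "t < T"
  shows "stop_section t \<noteq> {}"
proof -
  have sub: "{t..T} \<subseteq> {0..T}" using t by auto
  note cs = continuous_on_subset[OF _ sub]
  define C where "C = \<rho> + \<theta>max"
  \<comment> \<open>Chosen so that \<open>(9 + C\<^sup>2) * T \<le> \<delta> / 2\<close>, the
    smallness condition with \<open>d = 1\<close>; the summand 1 gives
    \<open>\<delta> \<ge> 1\<close> and thereby
    \<open>C\<^sup>2 / (2 * \<delta>) \<le> C\<^sup>2\<close>.\<close>
  define \<delta> where "\<delta> = 2 * ((9 + C\<^sup>2) * T) + 1"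
  have "0 \<le> (9 + C\<^sup>2) * T" using T_pos by (intro mult_nonneg_nonneg add_nonneg_nonneg) auto
  then have \<delta>: "1 \<le> \<delta>" by (simp add: \<delta>_def)
  obtain L1 where L1: "\<And>L s. L1 \<le> L \<Longrightarrow> s \<in> {t..T} \<Longrightarrow> 1 \<le> (A - mean t 0 s) + L * exp (\<Theta> t - \<Theta> s)"
  proof -
    have "continuous_on {t..T} (\<lambda>s. A - mean t 0 s)" "continuous_on {t..T} (\<lambda>s. exp (\<Theta> t - \<Theta> s))"
      by (intro continuous_intros cs mean_cont \<Theta>_cont)+
    from affine_family_lower_bound[OF this, of 1]
    obtain L0 where "\<forall>L\<ge>L0. \<forall>s\<in>{t..T}. 1 \<le> (A - mean t 0 s) + L * exp (\<Theta> t - \<Theta> s)" by force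
    then show ?thesis by (intro that[of L0]) blast
  qed
  let ?g = "\<lambda>s. exp (- \<rho> * (s - t)) * ((\<theta> s + \<rho>) * exp (\<Theta> t - \<Theta> s))"
  have "continuous_on {t..T} (drift t 0)" unfolding drift_def[abs_def]
    by (intro continuous_intros cs \<theta>_cont \<alpha>_cont mean_cont)
  moreover have "continuous_on {t..T} ?g" by (intro continuous_intros cs \<theta>_cont \<Theta>_cont)
  moreover have "0 < ?g s" if "s \<in> {t..T}" for s
    using \<theta>_pos[of s] that sub \<rho>_nonneg by (intro mult_pos_pos add_pos_nonneg) auto
  ultimately obtain L2 where L2: "\<And>L s. L2 \<le> L \<Longrightarrow> s \<in> {t..T} \<Longrightarrow> \<delta> \<le> drift t 0 s + L * ?g s"
    using affine_family_lower_bound[of t T "drift t 0" ?g \<delta>] by blast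
  define L where "L = max (- A) (max L1 L2)"
  have L: "- L \<le> A" "L1 \<le> L" "L2 \<le> L" by (auto simp: L_def)
  have m: "mean t (- L) s = mean t 0 s - L * exp (\<Theta> t - \<Theta> s)" for s
    using mean_shift[of t "- L" s 0] by simp
  have "V t (- L) \<le> ennreal (A - (- L))"
  proof (rule value_le_of_drift[OF t, where d = 1 and \<delta> = \<delta>])
    show "1 \<le> A - mean t (- L) s" if "s \<in> {t..T}" for s
      using L1[OF L(2) that] unfolding m by simp
    show "\<delta> \<le> drift t (- L) s" if "s \<in> {t..T}" for s
      using L2[OF L(3) that] unfolding drift_def m by (simp add: algebra_simps)
    have "C\<^sup>2 / (2 * \<delta>) \<le> C\<^sup>2 / 1" using \<delta> by (intro divide_left_mono) auto
    then have "(9 * (1 / 1 ^ 3) + C\<^sup>2 / (2 * \<delta>)) * (T - t) \<le> (9 + C\<^sup>2) * T"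
      using t by (intro mult_mono) auto
    also have "(9 + C\<^sup>2) * T \<le> \<delta> / 2" by (simp add: \<delta>_def)
    finally show "(9 * (1 / 1 ^ 3) + (\<rho> + \<theta>max)\<^sup>2 / (2 * \<delta>)) * (T - t) \<le> \<delta> / 2"
      unfolding C_def .
  qed (use \<delta> in auto)
  then have "- L \<in> stop_section t" using L(1) t by (intro stop_sectionI) auto
  then show ?thesis by blast
qed

text \<open>At the corner where both times equal \<open>T\<close>, the quantities
  \<open>A - mean\<close> and \<open>drift\<close> are positive by the two hypotheses. Half of each
  persists as a bound near the corner, and the factor \<open>T - t\<close> makes the smallness
  condition hold eventually.\<close>

lemma stop_section_near_horizon:
  assumes x: "x < A" "x < \<gamma>\<^sub>0 T"
  shows "\<forall>\<^sub>F t in at_left T. x \<in> stop_section t"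
proof -
  have TT: "T \<in> {0..T}" using T_pos by simp
  define d where "d = (A - x) / 2"
  define \<delta> where "\<delta> = drift T x T / 2"
  have "0 < \<theta> T + \<rho>" using \<theta>_pos[OF TT] \<rho>_nonneg by simp
  then have "0 < drift T x T" using x(2) by (simp add: drift_def \<gamma>\<^sub>0_def field_simps)
  then have \<delta>: "0 < \<delta>" "\<delta> < drift T x T" by (auto simp: \<delta>_def)
  have d: "0 < d" "d < A - mean T x T" using x by (auto simp: d_def)
  have fst_cont: "continuous_on ({0..T} \<times> {0..T}) (\<lambda>p. f (fst p))"
    and snd_cont: "continuous_on ({0..T} \<times> {0..T}) (\<lambda>p. f (snd p))"
    if "continuous_on {0..T} f" for f :: "real \<Rightarrow> real"
    by (rule continuous_on_compose2[OF that]; auto intro: continuous_intros)+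
  have cm: "continuous_on ({0..T} \<times> {0..T}) (\<lambda>p. mean (fst p) x (snd p))"
    unfolding mean_def
    by (intro continuous_intros fst_cont[OF \<Theta>_cont] snd_cont[OF \<Theta>_cont] fst_cont[OF drive_cont] snd_cont[OF drive_cont])
  have cd: "continuous_on ({0..T} \<times> {0..T}) (\<lambda>p. drift (fst p) x (snd p))"
    unfolding drift_def
    by (intro continuous_intros cm snd_cont[OF \<theta>_cont] snd_cont[OF \<alpha>_cont])
  have "continuous_on ({0..T} \<times> {0..T}) (\<lambda>p. A - mean (fst p) x (snd p))"
    by (intro continuous_intros cm)
  from continuous_corner[OF this T_pos, of d]
  have "\<forall>\<^sub>F t in at_left T. \<forall>s\<in>{t..T}. d < A - mean t x s" using d by simp
  moreover have "\<forall>\<^sub>F t in at_left T. \<forall>s\<in>{t..T}. \<delta> < drift t x s"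
    using continuous_corner[OF cd T_pos, of \<delta>] \<delta> by simp
  moreover have "\<forall>\<^sub>F t in at_left T. (9 * (1 / d ^ 3) + (\<rho> + \<theta>max)\<^sup>2 / (2 * \<delta>)) * (T - t) < \<delta> / 2"
  proof (rule order_tendstoD(2))
    show "((\<lambda>t. (9 * (1 / d ^ 3) + (\<rho> + \<theta>max)\<^sup>2 / (2 * \<delta>)) * (T - t)) \<longlongrightarrow>
        (9 * (1 / d ^ 3) + (\<rho> + \<theta>max)\<^sup>2 / (2 * \<delta>)) * (T - T)) (at_left T)"
      by (intro tendsto_intros)
  qed (use \<delta> in simp)
  moreover have "\<forall>\<^sub>F t in at_left T. t \<in> {0..<T}"
    unfolding eventually_at_left_field using T_pos by (intro exI[of _ 0]) auto
  ultimately show ?thesis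
  proof eventually_elim
    case (elim t)
    have t: "0 \<le> t" "t < T" using elim by auto
    have "V t x \<le> ennreal (A - x)"
      by (rule value_le_of_drift[OF t d(1) \<delta>(1)]) (use elim in \<open>auto intro: less_imp_le\<close>)
    then show ?case using t x by (intro stop_sectionI) auto
  qed
qed

text \<open>At \<open>T\<close> the section is the whole line and has no supremum; the value there
  is set to the prospective limit.\<close>

definition "boundary t = (if t < T then Sup (stop_section t) else min A (\<gamma>\<^sub>0 T))"

lemma boundary_upper:
  assumes t: "0 \<le> t" "t < T" and x: "x \<in> stop_section t"
  shows "x \<le> boundary t"
proof -
  have "bdd_above (stop_section t)"
    using stop_section_less(1)[OF t] by (intro bdd_aboveI[of _ A]) (rule less_imp_le)
  then show ?thesis using t x by (simp add: boundary_def cSup_upper)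
qed

text \<open>The section contains its supremum: points \<open>y\<close> of the section within
  \<open>\<epsilon>\<close> of it satisfy \<open>V t (boundary t) \<le> V t y = A - y\<close> by
  monotonicity.\<close>

lemma boundary_in_section:
  assumes t: "0 \<le> t" "t < T"
  shows "boundary t \<in> stop_section t"
proof (rule stop_sectionI)
  have b: "boundary t = Sup (stop_section t)" using t by (simp add: boundary_def)
  show "t \<in> {0..T}" using t by auto
  show bA: "boundary t \<le> A"
    unfolding b using stop_section_less(1)[OF t] stop_section_nonempty[OF t]
    by (intro cSup_least) (auto intro: less_imp_le)
  show "V t (boundary t) \<le> ennreal (A - boundary t)"
  proof (rule ennreal_le_epsilon)
    fix \<epsilon> :: real assume \<epsilon>: "0 < \<epsilon>"
    obtain y where y: "y \<in> stop_section t" "boundary t - \<epsilon> < y"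
      using less_cSupE[OF _ stop_section_nonempty[OF t], of "boundary t - \<epsilon>"] \<epsilon> b by auto
    have "V t (boundary t) \<le> V t y" by (rule value_antimono[OF t boundary_upper[OF t y(1)]])
    also have "\<dots> = ennreal (A - y)" by (rule stop_section_less(3)[OF t y(1)])
    also have "\<dots> \<le> ennreal ((A - boundary t) + \<epsilon>)" using y(2) by (intro ennreal_leI) simp
    also have "\<dots> = ennreal (A - boundary t) + ennreal \<epsilon>" using bA \<epsilon> by (intro ennreal_plus) auto
    finally show "V t (boundary t) \<le> ennreal (A - boundary t) + ennreal \<epsilon>" .
  qed
qed

lemma stop_section_eq:
  assumes t: "0 \<le> t" "t < T"
  shows "x \<in> stop_section t \<longleftrightarrow> x \<le> boundary t"
  using boundary_upper[OF t] stop_section_downward[OF t boundary_in_section[OF t]] by blast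

text \<open>Any \<open>x\<close> below the limit lies in the sections close to \<open>T\<close>,
  which gives the lower bound. The upper bound follows from
  \<open>boundary t \<le> min A (\<gamma>\<^sub>0 t)\<close> and the continuity of
  \<open>\<gamma>\<^sub>0\<close>.\<close>

lemma boundary_tendsto: "(boundary \<longlongrightarrow> min A (\<gamma>\<^sub>0 T)) (at_left T)"
proof (rule order_tendstoI)
  have ev: "\<forall>\<^sub>F t in at_left T. t \<in> {0..<T}"
    unfolding eventually_at_left_field using T_pos by (intro exI[of _ 0]) auto
  fix a
  {
    assume "a < min A (\<gamma>\<^sub>0 T)"
    then obtain x where x: "a < x" "x < min A (\<gamma>\<^sub>0 T)" using dense by blast
    have "\<forall>\<^sub>F t in at_left T. x \<in> stop_section t"
      using x by (intro stop_section_near_horizon) auto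
    then show "\<forall>\<^sub>F t in at_left T. a < boundary t"
      using ev
    proof eventually_elim
      case (elim t)
      then have "x \<le> boundary t" by (intro boundary_upper) auto
      then show ?case using x(1) by linarith
    qed
  next
    assume "min A (\<gamma>\<^sub>0 T) < a"
    have "\<theta> s + \<rho> \<noteq> 0" if "s \<in> {0..T}" for s
      using \<theta>_pos[OF that] \<rho>_nonneg by simp
    then have "continuous_on {0..T} \<gamma>\<^sub>0"
      unfolding \<gamma>\<^sub>0_def[abs_def] by (intro continuous_intros \<theta>_cont \<alpha>_cont) blast
    then have "(\<gamma>\<^sub>0 \<longlongrightarrow> \<gamma>\<^sub>0 T) (at_left T)"
      using T_pos unfolding continuous_on_def at_within_Icc_at_left[OF T_pos, symmetric] by auto
    then have "((\<lambda>t. min A (\<gamma>\<^sub>0 t)) \<longlongrightarrow> min A (\<gamma>\<^sub>0 T)) (at_left T)"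
      by (intro tendsto_min tendsto_const)
    from order_tendstoD(2)[OF this \<open>min A (\<gamma>\<^sub>0 T) < a\<close>]
    show "\<forall>\<^sub>F t in at_left T. boundary t < a"
      using ev
    proof eventually_elim
      case (elim t)
      then have t: "0 \<le> t" "t < T" by auto
      note l = stop_section_less[OF t boundary_in_section[OF t]]
      show ?case using elim l(1,2) by linarith
    qed
  }
qed

end

theorem proposition1:
  fixes M :: "'a measure"
    and W :: "real \<Rightarrow> 'a \<Rightarrow> real"
    and X :: "real \<Rightarrow> real \<Rightarrow> real \<Rightarrow> 'a \<Rightarrow> real"
    and \<theta> \<alpha> \<gamma> :: "real \<Rightarrow> real"
    and T A \<rho> :: real
  assumes "T > 0" and "\<rho> \<ge> 0"
    and "continuously_differentiable_on \<theta> {0..T}"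
    and "continuously_differentiable_on \<alpha> {0..T}"
    and "\<And>s. s \<in> {0..T} \<Longrightarrow> \<theta> s > 0"
    and "brownian_motion M T W"
    and "\<And>t x. t \<in> {0..T} \<Longrightarrow> ou_strong_solution M T W \<theta> \<alpha> t x (X t x)"
    and "\<And>t. \<gamma> t = (\<theta> t * \<alpha> t + \<rho> * A) / (\<theta> t + \<rho>)"
  shows "\<exists>b :: real \<Rightarrow> real.
           (\<forall>t\<in>{0..<T}. b t < A) \<and>
           stopping_set M T W X \<rho> A = {(t, x). t \<in> {0..<T} \<and> x \<le> b t} \<union> {T} \<times> UNIV \<and>
           (\<forall>t\<in>{0..<T}. b t \<le> \<gamma> t) \<and>
           (b \<longlongrightarrow> b T) (at_left T) \<and>
           b T = min A (\<gamma> T)"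
proof -
  have C1: "continuous_on {0..T} f" if "continuously_differentiable_on f {0..T}" for f
  proof -
    obtain f' where "\<And>s. s \<in> {0..T} \<Longrightarrow> (f has_real_derivative f' s) (at s within {0..T})"
      using \<open>continuously_differentiable_on f {0..T}\<close> unfolding continuously_differentiable_on_def by blast
    then show ?thesis by (rule DERIV_continuous_on)
  qed
  interpret ou_stopping M W X \<theta> \<alpha> T A \<rho>
    by (unfold_locales; (rule assms C1)+)
  have \<gamma>: "\<gamma> t = \<gamma>\<^sub>0 t" for t using assms(8) by (simp add: \<gamma>\<^sub>0_def)
  have bT: "boundary T = min A (\<gamma> T)" by (simp add: boundary_def \<gamma>)
  have 1: "boundary t < A" "boundary t \<le> \<gamma> t" if "t \<in> {0..<T}" for t
  proof -
    from that have t: "0 \<le> t" "t < T" by auto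
    show "boundary t < A" "boundary t \<le> \<gamma> t"
      using stop_section_less(1,2)[OF t boundary_in_section[OF t]] by (simp_all add: \<gamma>)
  qed
  have "(t, x) \<in> stopping_set M T W X \<rho> A \<longleftrightarrow> t \<in> {0..<T} \<and> x \<le> boundary t \<or> t = T" for t x
  proof (cases "t \<in> {0..<T}")
    case True
    then have "(t, x) \<in> stopping_set M T W X \<rho> A \<longleftrightarrow> x \<in> stop_section t"
      by (auto simp: stopping_set_def stop_section_def)
    then show ?thesis using True stop_section_eq[of t x] by auto
  next
    \<comment> \<open>Outside the half-open interval only \<open>t = T\<close> belongs to the time
      range, and there the value equals the gain for every \<open>x\<close>.\<close>
    case False
    then show ?thesis using value_horizon T_pos by (auto simp: stopping_set_def)
  qed
  then have 2: "stopping_set M T W X \<rho> A = {(t, x). t \<in> {0..<T} \<and> x \<le> boundary t} \<union> {T} \<times> UNIV"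
    by auto
  show ?thesis
    using 1 2 boundary_tendsto bT by (intro exI[of _ boundary]) (simp add: \<gamma>)
qed

end
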